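(* Let $a>1$ and $c>-1$, and for $N\in\mathbb{N}$ let $Q(z)=|z|^2-\frac{2c}{N}\log|z-a|$. Let $p_j\equiv p_{j,N}$ be the orthonormal polynomials of degree $j$ with respect to $e^{-NQ(z)}\,dA(z)$, $dA(z)=\frac{d^2z}{\pi}$, and let $K_N(z,w)=e^{-\frac N2(Q(z)+Q(w))}\sum_{j=0}^{N-1}p_j(z)\overline{p_j(w)}$. Let $p$ be a point with $|p|=1$. Then, as $N\to\infty$, up to cocycles (i.e. after multiplication by $g_N(z)\overline{g_N(w)}$ for suitable continuous unimodular functions $g_N$), $$\frac1N K_N\Big(p+\frac{p\,z}{\sqrt N},\,p+\frac{p\,w}{\sqrt N}\Big)\to G(z,w)\,\frac12\operatorname{erfc}\Big(\frac{z+\bar w}{\sqrt2}\Big),\qquad G(z,w)=e^{z\bar w-\frac{|z|^2}{2}-\frac{|w|^2}{2}},$$ uniformly for $z,w$ in compact subsets of $\mathbb{C}$.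
   Context: A correlation kernel of a determinantal point process is only determined up to a cocycle $g_N(z)\overline{g_N(w)}$ with $g_N$ continuous and unimodular, since such factors do not change the correlation functions $\det[K_N(z_j,z_l)]$. *)

theory Defs
  imports "HOL-Complex_Analysis.Complex_Analysis" "HOL-Computational_Algebra.Polynomial"
begin

definition cerf :: "complex \<Rightarrow> complex" where
  "cerf z = of_real (2 / sqrt pi) * contour_integral (linepath 0 z) (\<lambda>t. exp (- (t ^ 2)))"

definition cerfc :: "complex \<Rightarrow> complex" where
  "cerfc z = 1 - cerf z"

definition Qpot :: "real \<Rightarrow> real \<Rightarrow> nat \<Rightarrow> complex \<Rightarrow> real" where
  "Qpot a c N z = (cmod z)^2 - 2 * c / real N * ln (cmod (z - of_real a))"

text \<open>p is the family of orthonormal polynomials (degree j, positive leading coefficient)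
  with respect to the measure W(z) dA(z), dA = d^2 z / pi (Lebesgue measure on C divided by pi).\<close>
definition orthonormal_polys :: "(complex \<Rightarrow> real) \<Rightarrow> (nat \<Rightarrow> complex poly) \<Rightarrow> bool" where
  "orthonormal_polys W p \<longleftrightarrow>
     (\<forall>j. degree (p j) = j \<and> lead_coeff (p j) \<in> \<real> \<and> Re (lead_coeff (p j)) > 0) \<and>
     (\<forall>j k. integrable lborel (\<lambda>z. poly (p j) z * cnj (poly (p k) z) * of_real (W z / pi)) \<and>
            (LINT z|lborel. poly (p j) z * cnj (poly (p k) z) * of_real (W z / pi))
              = (if j = k then 1 else 0))"

definition kernel :: "real \<Rightarrow> real \<Rightarrow> (nat \<Rightarrow> nat \<Rightarrow> complex poly) \<Rightarrow> nat \<Rightarrow> complex \<Rightarrow> complex \<Rightarrow> complex" where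
  "kernel a c P N z w =
     of_real (exp (- real N / 2 * (Qpot a c N z + Qpot a c N w))) *
     (\<Sum>j<N. poly (P N j) z * cnj (poly (P N j) w))"

definition Gfun :: "complex \<Rightarrow> complex \<Rightarrow> complex" where
  "Gfun z w = exp (z * cnj w - of_real ((cmod z)^2 / 2) - of_real ((cmod w)^2 / 2))"

end

theory Submission
  imports Defs "HOL-Probability.Probability" "HOL-Real_Asymp.Real_Asymp"
begin

text \<open>
  On a disc of radius \<open>r > 1\<close> the weight equals \<open>exp (- N \<bar>z\<bar>\<^sup>2) / \<bar>\<phi> z\<bar>\<^sup>2\<close> with
  \<open>\<phi> z = (a - z) powr (- c)\<close> holomorphic and zero-free, and polynomials of degree about \<open>N\<close> have
  negligible mass outside this disc. So \<open>f \<mapsto> f / \<phi>\<close> is almost an isometry into the Fock space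
  with weight \<open>exp (- N \<bar>z\<bar>\<^sup>2)\<close>, except that it does not preserve the degree. Replacing \<open>\<phi>\<close> and
  \<open>1 / \<phi>\<close> by polynomials of a fixed degree \<open>m\<close> changes degrees by at most \<open>m\<close>, and each single degree
  carries a vanishing fraction of the Ginibre kernel because the Poisson mode \<open>n ^ n * exp (- n) / n!\<close> tends to 0.
  Hence \<open>\<phi> z * cnj (\<phi> w)\<close> times the Ginibre kernel almost reproduces, and therefore approximates
  the kernel of the perturbed weight uniformly on the disc. At the scale \<open>1 / sqrt N\<close> the phase of \<open>\<phi>\<close>
  is constant in the limit, which leaves the edge asymptotics of the Ginibre kernel, i.e. of the
  sections \<open>exp (- x) * (\<Sum>j\<le>n. x ^ j / j!)\<close> at \<open>x = n + sqrt (2 * n) * v\<close>. Their derivative in \<open>v\<close> is an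
  approximate Gaussian, and dominated convergence gives both its Stirling constant and the value at \<open>v = 0\<close>.
\<close>

section \<open>Rotations and radial functions\<close>

text \<open>Almost reproducing suffices by duality. With \<open>w\<close> fixed, let the polynomial
  \<open>D\<close> be the true kernel minus the candidate. Its squared norm in the perturbed weight
  is \<open>D w\<close> minus its pairing with the candidate, so the approximate reproducing
  property, tested on \<open>D\<close> itself, bounds it by a small multiple of the Fock norm of
  \<open>D\<close>. In turn the Fock norm is at most a constant times the perturbed norm. One factor
  cancels, and point evaluation gives an error that is small relative to
  \<open>N * exp (N * (|z|^2 + |w|^2) / 2)\<close>, which the weight reduces to order
  \<open>N\<close>. Two polynomial substitutes are needed because the multiplier changes slot:
  \<open>V * cnj \<phi> = 1 / \<phi>\<close> on the disc, so multiplying the kernel section by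
  \<phi> acts as dividing the test polynomial by \<phi>. Their accuracy is fixed before
  \<open>N\<close> grows, which keeps \<open>m\<close> bounded; the error bound then tends to a
  constant times the accuracy. The cut of \<phi> starts at \<open>a\<close>, so \<open>a > 1\<close>
  leaves room for a disc strictly larger than the unit disc, on which the mass concentrates.\<close>

lemma borel_measurable_cnj [measurable]: "cnj \<in> borel_measurable borel"
  by (intro borel_measurable_continuous_onI continuous_intros)

text \<open>The passage to \<open>real ^ 2\<close> serves to use invariance of Lebesgue measure
  under orthogonal transformations of Cartesian spaces; planar rotations are obtained from it by
  transport.\<close>

definition complex_of_vec :: "real ^ 2 \<Rightarrow> complex" where
  "complex_of_vec v = Complex (v $ 1) (v $ 2)"

lemma complex_of_vec_measurable [measurable]: "complex_of_vec \<in> borel_measurable borel"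
proof -
  have "continuous_on UNIV complex_of_vec"
    unfolding complex_of_vec_def Complex_eq by (intro continuous_intros)
  thus ?thesis by (rule borel_measurable_continuous_onI)
qed

lemma lborel_complex_of_vec: "distr lborel borel complex_of_vec = lborel"
proof (rule lborel_eqI[symmetric])
  fix l u :: complex
  assume le: "\<And>b. b \<in> Basis \<Longrightarrow> l \<bullet> b \<le> u \<bullet> b"
  have le': "Re l \<le> Re u" "Im l \<le> Im u"
    using le[of 1] le[of \<i>] by (auto simp: Basis_complex_def)
  define L U :: "real ^ 2" where "L = vector [Re l, Im l]" and "U = vector [Re u, Im u]"
  have LU: "L $ 1 = Re l" "L $ 2 = Im l" "U $ 1 = Re u" "U $ 2 = Im u"
    by (simp_all add: L_def U_def)
  have eq: "complex_of_vec -` box l u = box L U"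
    by (auto simp: complex_of_vec_def mem_box_cart in_box_complex_iff forall_2 LU)
  have ne: "cbox L U \<noteq> {}"
    using le' forall_2[of "\<lambda>i. L $ i \<le> U $ i"] by (auto simp: interval_eq_empty_cart LU not_less)
  have "emeasure lborel (box L U) = ennreal (measure lborel (box L U))"
    using emeasure_lborel_box_finite[of L U] by (intro emeasure_eq_ennreal_measure) auto
  also have "measure lborel (box L U) = measure lborel (cbox L U)"
    by (simp add: measure_lborel_box_eq measure_lborel_cbox_eq)
  also have "\<dots> = (Re u - Re l) * (Im u - Im l)"
    using ne by (simp add: content_cbox_cart UNIV_2 LU)
  finally have "emeasure lborel (box L U) = (Re u - Re l) * (Im u - Im l)" .
  thus "emeasure (distr lborel borel complex_of_vec) (box l u) = (\<Prod>b\<in>Basis. (u - l) \<bullet> b)"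
    by (simp add: emeasure_distr eq Basis_complex_def)
qed simp

lemma lborel_distr_rotate:
  fixes u :: complex
  assumes u: "cmod u = 1"
  shows "distr lborel borel ((*) u) = lborel"
proof (rule lborel_eqI[symmetric])
  fix l v :: complex
  assume le: "\<And>b. b \<in> Basis \<Longrightarrow> l \<bullet> b \<le> v \<bullet> b"
  \<comment> \<open>The inverse rotation, multiplication by \<open>cnj u\<close> in real
    coordinates. The preimage of a box under multiplication by \<open>u\<close> is then an image
    under \<open>R\<close>, the form in which measure preservation applies.\<close>
  define R :: "real ^ 2 \<Rightarrow> real ^ 2" where
    "R x = vector [Re u * x $ 1 + Im u * x $ 2, - Im u * x $ 1 + Re u * x $ 2]" for x
  have uu: "u * cnj u = 1" using u by (simp add: complex_norm_square[symmetric])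
  have cR: "complex_of_vec (R x) = cnj u * complex_of_vec x" for x
    by (simp add: complex_of_vec_def R_def complex_eq_iff)
  have inj: "complex_of_vec x = complex_of_vec y \<longleftrightarrow> x = y" for x y
    by (simp add: complex_of_vec_def vec_eq_iff forall_2)
  have nrm: "norm (R x) = norm x" for x
  proof -
    have n: "norm y = cmod (complex_of_vec y)" for y :: "real ^ 2"
      by (simp add: norm_vec_def L2_set_def sum_2 complex_of_vec_def cmod_def)
    show ?thesis using u by (simp add: n cR norm_mult)
  qed
  have lin: "linear R"
    by (rule linearI) (simp_all add: R_def vec_eq_iff forall_2 algebra_simps)
  have orth: "orthogonal_transformation R"
    using lin nrm by (simp add: orthogonal_transformation)
  let ?S = "complex_of_vec -` box l v"
  have Sb: "?S \<in> sets borel"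
    using measurable_sets[OF complex_of_vec_measurable, of "box l v"] by simp
  have em: "emeasure lborel ?S = emeasure lborel (box l v)"
    unfolding lborel_complex_of_vec[symmetric] by (simp add: emeasure_distr)
  have Sl: "?S \<in> lmeasurable"
    using Sb em emeasure_lborel_box_finite[of l v] by (auto simp: fmeasurable_def)
  have im: "complex_of_vec -` ((*) u -` box l v) = R ` ?S"
  proof (intro subset_antisym subsetI)
    fix x assume x: "x \<in> complex_of_vec -` ((*) u -` box l v)"
    obtain y where y: "complex_of_vec y = u * complex_of_vec x"
    proof
      show "complex_of_vec (vector [Re (u * complex_of_vec x), Im (u * complex_of_vec x)]) = u * complex_of_vec x"
        by (simp add: complex_of_vec_def complex_eq_iff)
    qed
    have "complex_of_vec (R y) = (u * cnj u) * complex_of_vec x" by (simp add: cR y)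
    hence "x = R y" by (simp add: uu inj)
    with x y show "x \<in> R ` ?S" by auto
  next
    fix x assume "x \<in> R ` ?S"
    then obtain y where y: "y \<in> ?S" "x = R y" by auto
    have "u * complex_of_vec x = (u * cnj u) * complex_of_vec y" by (simp add: cR y)
    with y show "x \<in> complex_of_vec -` ((*) u -` box l v)" by (simp add: uu)
  qed
  have meas: "complex_of_vec -` ((*) u -` box l v) \<in> sets borel"
    using measurable_sets[of "\<lambda>x. u * complex_of_vec x" borel borel "box l v"] by (simp add: vimage_def)
  have "emeasure (distr lborel borel ((*) u)) (box l v) = emeasure lborel ((*) u -` box l v)"
    by (simp add: emeasure_distr)
  also have "\<dots> = emeasure lborel (complex_of_vec -` ((*) u -` box l v))"
  proof -
    have "(*) u -` box l v \<in> sets borel"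
      using measurable_sets[of "(*) u" borel borel "box l v"] by simp
    thus ?thesis
      by (subst lborel_complex_of_vec[symmetric]) (simp add: emeasure_distr)
  qed
  also have "\<dots> = emeasure lebesgue (R ` ?S)" using meas by (simp add: im)
  also have "\<dots> = ennreal (measure lebesgue (R ` ?S))"
    using measurable_orthogonal_image[OF orth Sl] by (simp add: emeasure_eq_measure2)
  also have "\<dots> = ennreal (measure lebesgue ?S)"
    by (simp add: measure_orthogonal_image[OF orth Sl])
  also have "\<dots> = emeasure lebesgue ?S" using Sl by (simp add: emeasure_eq_measure2)
  also have "\<dots> = emeasure lborel (box l v)" using Sb em by simp
  also have "\<dots> = (\<Prod>b\<in>Basis. (v - l) \<bullet> b)" using le by (simp add: emeasure_lborel_box)
  finally show "emeasure (distr lborel borel ((*) u)) (box l v) = (\<Prod>b\<in>Basis. (v - l) \<bullet> b)" .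
qed simp

text \<open>Polar coordinates for radial functions, without the angle: the disc of radius
  \<open>sqrt r\<close> has area \<open>pi * r\<close>, and half-lines form an intersection-stable
  generator of the Borel sets.\<close>

lemma distr_norm_square:
  "distr (lborel :: complex measure) borel (\<lambda>z. (cmod z)^2) =
     density lborel (\<lambda>t. ennreal (pi * indicator {0..} t))" (is "?L = ?R")
proof (rule measure_eqI_generator_eq[where E = "range (\<lambda>r::real. {..r})" and \<Omega> = UNIV and A = "\<lambda>n. {..real n}"])
  show "Int_stable (range (\<lambda>r::real. {..r}))" by (auto simp: Int_stable_def)
  have em: "emeasure ?L {..r} = ennreal (pi * max 0 r)" for r
  proof -
    have "(\<lambda>z. (cmod z)^2) -` {..r} = (if r < 0 then {} else cball 0 (sqrt r))"
    proof (cases "r < 0")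
      case True thus ?thesis by (auto simp: not_le) (smt (verit) zero_le_power2)
    next
      case False thus ?thesis by (auto simp: real_le_rsqrt dist_norm) (metis abs_norm_cancel real_le_rsqrt real_sqrt_abs real_sqrt_le_iff)
    qed
    moreover have "emeasure lborel (cball (0::complex) (sqrt r)) = ennreal (pi * r)" if "r \<ge> 0"
      using that by (subst emeasure_cball) (auto simp: unit_ball_vol_2)
    ultimately show ?thesis by (simp add: emeasure_distr max_def)
  qed
  have em': "emeasure ?R {..r} = ennreal (pi * max 0 r)" for r
  proof -
    have "emeasure ?R {..r} = (\<integral>\<^sup>+ t. ennreal pi * indicator {0..r} t \<partial>lborel)"
      by (subst emeasure_density, simp, simp)
         (intro nn_integral_cong, auto simp: indicator_def)
    also have "\<dots> = ennreal (pi * max 0 r)"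
      by (subst nn_integral_cmult) (auto simp: max_def ennreal_mult' emeasure_lborel_Icc_eq)
    finally show ?thesis .
  qed
  show "\<And>X. X \<in> range (\<lambda>r::real. {..r}) \<Longrightarrow> emeasure ?L X = emeasure ?R X"
    using em em' by auto
  show "emeasure ?L {..real i} \<noteq> \<infinity>" for i by (simp add: em)
  show "sets ?L = sigma_sets UNIV (range (\<lambda>r::real. {..r}))"
    by (simp add: borel_eq_atMost)
  show "sets ?R = sigma_sets UNIV (range (\<lambda>r::real. {..r}))"
    by (simp add: borel_eq_atMost)
  show "(\<Union>i. {..real i}) = UNIV" by (auto intro: real_arch_simple)
qed auto

lemma nn_integral_norm_square:
  assumes [measurable]: "f \<in> borel_measurable borel"
  shows "(\<integral>\<^sup>+ z. f ((cmod z)^2) \<partial>lborel) = (\<integral>\<^sup>+ t. ennreal (pi * indicator {0..} t) * f t \<partial>lborel)"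
proof -
  have "(\<integral>\<^sup>+ z. f ((cmod z)^2) \<partial>lborel) = (\<integral>\<^sup>+ t. f t \<partial>distr (lborel :: complex measure) borel (\<lambda>z. (cmod z)^2))"
    by (subst nn_integral_distr) simp_all
  also have "\<dots> = (\<integral>\<^sup>+ t. ennreal (pi * indicator {0..} t) * f t \<partial>lborel)"
    unfolding distr_norm_square by (subst nn_integral_density) simp_all
  finally show ?thesis .
qed

section \<open>Gaussian inner product of polynomials\<close>

text \<open>With \<open>t = (cmod z)^2\<close> the integral becomes a Gamma integral, which is read
  off from the total mass 1 of the Erlang density.\<close>

lemma nn_integral_gauss_moment:
  assumes s: "s > 0"
  shows "(\<integral>\<^sup>+ z. ennreal (cmod z ^ (2 * j) * exp (- s * (cmod z)^2)) \<partial>lborel) = ennreal (pi * fact j / s ^ (j + 1))"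
proof -
  have "(\<integral>\<^sup>+ z. ennreal (cmod z ^ (2 * j) * exp (- s * (cmod z)^2)) \<partial>lborel) =
        (\<integral>\<^sup>+ z. ennreal (((cmod z)^2) ^ j * exp (- s * (cmod z)^2)) \<partial>lborel)"
    by (simp add: power_mult)
  also have "\<dots> = (\<integral>\<^sup>+ t. ennreal (pi * indicator {0..} t) * ennreal (t ^ j * exp (- s * t)) \<partial>lborel)"
    by (rule nn_integral_norm_square) simp
  also have "\<dots> = (\<integral>\<^sup>+ t. ennreal (pi * fact j / s ^ (j + 1)) * ennreal (erlang_density j s t) \<partial>lborel)"
    using s by (intro nn_integral_cong)
      (auto simp: erlang_density_def indicator_def ennreal_mult'[symmetric] field_simps)
  also have "\<dots> = ennreal (pi * fact j / s ^ (j + 1)) * (\<integral>\<^sup>+ t. ennreal (erlang_density j s t) \<partial>lborel)"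
    by (rule nn_integral_cmult) simp
  also have "(\<integral>\<^sup>+ t. ennreal (erlang_density j s t) \<partial>lborel) = 1"
    using nn_integral_erlang_ith_moment[OF s, of j 0] by simp
  finally show ?thesis by simp
qed

lemma has_bochner_integral_gauss_moment:
  assumes s: "s > 0"
  shows "has_bochner_integral lborel (\<lambda>z. cmod z ^ (2 * j) * exp (- s * (cmod z)^2)) (pi * fact j / s ^ (j + 1))"
  by (rule has_bochner_integral_nn_integral)
     (use s nn_integral_gauss_moment[OF s, of j] in auto)

lemma integrable_gauss_monomials:
  assumes s: "s > 0"
  shows "integrable lborel (\<lambda>z. z ^ j * cnj z ^ k * of_real (exp (- s * (cmod z)^2)))"
proof (rule Bochner_Integration.integrable_bound)
  show "integrable lborel (\<lambda>z::complex. cmod z ^ (2 * j) * exp (- s * (cmod z)^2) + cmod z ^ (2 * k) * exp (- s * (cmod z)^2))"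
    using has_bochner_integral_gauss_moment[OF s, unfolded has_bochner_integral_iff] by (intro Bochner_Integration.integrable_add) blast+
  have "norm (z ^ j * cnj z ^ k * of_real (exp (- s * (cmod z)^2)))
          \<le> norm (cmod z ^ (2 * j) * exp (- s * (cmod z)^2) + cmod z ^ (2 * k) * exp (- s * (cmod z)^2))" for z :: complex
  proof -
    have "2 * (cmod z ^ j * cmod z ^ k) \<le> (cmod z ^ j)^2 + (cmod z ^ k)^2"
      using sum_squares_bound[of "cmod z ^ j" "cmod z ^ k"] by simp
    also have "\<dots> = cmod z ^ (2 * j) + cmod z ^ (2 * k)" by (simp add: power_even_eq)
    finally have "cmod z ^ j * cmod z ^ k \<le> cmod z ^ (2 * j) + cmod z ^ (2 * k)"
      using zero_le_power[of "cmod z" j] zero_le_power[of "cmod z" k] by (smt (verit) mult_nonneg_nonneg norm_ge_zero)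
    hence "cmod z ^ j * cmod z ^ k * exp (- s * (cmod z)^2) \<le> (cmod z ^ (2 * j) + cmod z ^ (2 * k)) * exp (- s * (cmod z)^2)"
      by (rule mult_right_mono) simp
    thus ?thesis by (simp add: norm_mult norm_power algebra_simps)
  qed
  thus "AE z in lborel. norm (z ^ j * cnj z ^ k * of_real (exp (- s * (cmod z)^2)))
          \<le> norm (cmod z ^ (2 * j) * exp (- s * (cmod z)^2) + cmod z ^ (2 * k) * exp (- s * (cmod z)^2))" by simp
qed simp

lemma integral_gauss_monomials:
  assumes s: "s > 0"
  shows "(LINT z|lborel. z ^ j * cnj z ^ k * of_real (exp (- s * (cmod z)^2))) =
           (if j = k then of_real (pi * fact j / s ^ (j + 1)) else 0)"
proof (cases "j = k")
  case True
  have "(LINT z|lborel. z ^ j * cnj z ^ k * of_real (exp (- s * (cmod z)^2))) =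
        (LINT z|lborel. of_real (cmod z ^ (2 * j) * exp (- s * (cmod z)^2)) :: complex)"
    using True by (intro Bochner_Integration.integral_cong)
      (auto simp: power_mult_distrib[symmetric] complex_norm_square[symmetric] power_mult)
  also have "\<dots> = of_real (LINT z|lborel. cmod z ^ (2 * j) * exp (- s * (cmod z)^2))"
    using has_bochner_integral_gauss_moment[OF s, of j]
    unfolding has_bochner_integral_iff by (intro integral_of_real) blast
  also have "\<dots> = of_real (pi * fact j / s ^ (j + 1))"
    by (simp only: has_bochner_integral_integral_eq[OF has_bochner_integral_gauss_moment[OF s]])
  finally show ?thesis using True by simp
next
  case False
  define F where "F z = z ^ j * cnj z ^ k * of_real (exp (- s * (cmod z)^2))" for z :: complex
  \<comment> \<open>The angle is chosen so that \<open>u ^ j * cnj u ^ k = - 1\<close>; rotation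
    invariance then makes the integral equal to its own negative.\<close>
  define u where "u = cis (pi / (real j - real k))"
  have [measurable]: "F \<in> borel_measurable borel" unfolding F_def by simp
  have u: "cmod u = 1" by (simp add: u_def)
  have uu: "u ^ j * cnj u ^ k = - 1"
  proof -
    have "u ^ j * cnj u ^ k = cis (real j * (pi / (real j - real k))) * cis (- (real k * (pi / (real j - real k))))"
      unfolding u_def cis_cnj Complex.DeMoivre by (simp only: mult_minus_right)
    also have "\<dots> = cis ((real j - real k) * (pi / (real j - real k)))"
      unfolding cis_mult by (simp add: algebra_simps diff_divide_distrib)
    also have "\<dots> = - 1" using False by simp
    finally show ?thesis .
  qed
  have "(LINT z|lborel. F z) = (LINT z|distr lborel borel ((*) u). F z)"
    by (simp add: lborel_distr_rotate[OF u])
  also have "\<dots> = (LINT z|lborel. F (u * z))" by (rule integral_distr) simp_all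
  also have "\<dots> = (LINT z|lborel. (u ^ j * cnj u ^ k) * F z)"
    by (simp add: F_def power_mult_distrib norm_mult u mult_ac)
  also have "\<dots> = - (LINT z|lborel. F z)" unfolding uu by simp
  finally have "(LINT z|lborel. F z) = 0" by simp
  thus ?thesis using False by (simp add: F_def)
qed

section \<open>The Fock norm in coefficients and point evaluation\<close>

lemma poly_eq_sum_lessThan:
  fixes f :: "'a :: comm_semiring_1 poly"
  assumes "degree f < M"
  shows "poly f z = (\<Sum>i<M. coeff f i * z ^ i)"
proof -
  have "poly f z = (\<Sum>i\<le>degree f. coeff f i * z ^ i)" by (rule poly_altdef)
  also have "\<dots> = (\<Sum>i<M. coeff f i * z ^ i)"
    by (rule sum.mono_neutral_left) (use assms in \<open>auto simp: coeff_eq_0 not_le\<close>)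
  finally show ?thesis .
qed

text \<open>The \<open>L^2\<close> norm for the density \<open>exp (- s * (cmod z)^2) / pi\<close>,
  in coefficients: monomials are orthogonal there with squared norm
  \<open>fact j / s ^ (j + 1)\<close>. The agreement with the integral is
  \<open>fock_norm_integral\<close>.\<close>

definition fock_norm :: "real \<Rightarrow> complex poly \<Rightarrow> real" where
  "fock_norm s f = sqrt (\<Sum>j\<le>degree f. (cmod (coeff f j))^2 * fact j / s ^ (j + 1))"

lemma fock_norm_nonneg: "s > 0 \<Longrightarrow> fock_norm s f \<ge> 0"
  unfolding fock_norm_def by (intro real_sqrt_ge_zero sum_nonneg) auto

lemma fock_norm_square:
  assumes "degree f < M" "s > 0"
  shows "(fock_norm s f)^2 = (\<Sum>j<M. (cmod (coeff f j))^2 * fact j / s ^ (j + 1))"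
proof -
  have "(fock_norm s f)^2 = (\<Sum>j\<le>degree f. (cmod (coeff f j))^2 * fact j / s ^ (j + 1))"
    unfolding fock_norm_def using assms by (intro real_sqrt_pow2 sum_nonneg) auto
  also have "\<dots> = (\<Sum>j<M. (cmod (coeff f j))^2 * fact j / s ^ (j + 1))"
    by (rule sum.mono_neutral_left) (use assms in \<open>auto intro: coeff_eq_0\<close>)
  finally show ?thesis .
qed

lemma gauss_inner_polys:
  assumes s: "s > 0" and deg: "degree f < M" "degree g < M"
  shows "has_bochner_integral lborel (\<lambda>z. poly f z * cnj (poly g z) * of_real (exp (- s * (cmod z)^2) / pi))
           (\<Sum>j<M. coeff f j * cnj (coeff g j) * of_real (fact j / s ^ (j + 1)))"
proof -
  have eq: "poly f z * cnj (poly g z) * of_real (exp (- s * (cmod z)^2) / pi) =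
      (\<Sum>i<M. \<Sum>j<M. (coeff f i * cnj (coeff g j) / of_real pi) * (z ^ i * cnj z ^ j * of_real (exp (- s * (cmod z)^2))))" for z
    unfolding poly_eq_sum_lessThan[OF deg(1)] poly_eq_sum_lessThan[OF deg(2)] cnj_sum sum_product
    by (simp add: sum_distrib_right sum_distrib_left sum_divide_distrib mult_ac)
  have hb: "has_bochner_integral lborel (\<lambda>z. z ^ i * cnj z ^ j * of_real (exp (- s * (cmod z)^2)))
      (if i = j then of_real (pi * fact i / s ^ (i + 1)) else 0)" for i j
    using integrable_gauss_monomials[OF s, of i j] integral_gauss_monomials[OF s, of i j] by (simp add: has_bochner_integral_iff)
  have "has_bochner_integral lborel (\<lambda>z. poly f z * cnj (poly g z) * of_real (exp (- s * (cmod z)^2) / pi))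
     (\<Sum>i<M. \<Sum>j<M. (coeff f i * cnj (coeff g j) / of_real pi) * (if i = j then of_real (pi * fact i / s ^ (i + 1)) else 0))"
    unfolding eq by (intro has_bochner_integral_sum has_bochner_integral_mult_right hb)
  also have "(\<Sum>i<M. \<Sum>j<M. (coeff f i * cnj (coeff g j) / of_real pi) * (if i = j then of_real (pi * fact i / s ^ (i + 1)) else 0))
     = (\<Sum>i<M. coeff f i * cnj (coeff g i) * of_real (fact i / s ^ (i + 1)))"
    by (intro sum.cong refl) (simp add: if_distrib[of "\<lambda>x. _ * x"] sum.delta cong: if_cong)
  finally show ?thesis .
qed

lemma fock_norm_integral:
  assumes s: "s > 0"
  shows "has_bochner_integral lborel (\<lambda>z. (cmod (poly f z))^2 * (exp (- s * (cmod z)^2) / pi)) ((fock_norm s f)^2)"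
proof -
  have "has_bochner_integral lborel (\<lambda>z. Re (poly f z * cnj (poly f z) * of_real (exp (- s * (cmod z)^2) / pi)))
           (Re (\<Sum>j<Suc (degree f). coeff f j * cnj (coeff f j) * of_real (fact j / s ^ (j + 1))))"
    by (intro has_bochner_integral_Re gauss_inner_polys s) auto
  also have "(\<lambda>z. Re (poly f z * cnj (poly f z) * of_real (exp (- s * (cmod z)^2) / pi))) =
       (\<lambda>z. (cmod (poly f z))^2 * (exp (- s * (cmod z)^2) / pi))"
    unfolding complex_norm_square[symmetric] of_real_mult[symmetric] Re_complex_of_real ..
  also have "Re (\<Sum>j<Suc (degree f). coeff f j * cnj (coeff f j) * of_real (fact j / s ^ (j + 1))) = (fock_norm s f)^2"
    unfolding fock_norm_square[OF lessI s] complex_norm_square[symmetric] of_real_mult[symmetric] of_real_sum[symmetric] Re_complex_of_real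
    by simp
  finally show ?thesis .
qed

lemma sum_power_fact_le_exp:
  assumes "finite J" "x \<ge> (0::real)"
  shows "(\<Sum>j\<in>J. x ^ j / fact j) \<le> exp x"
proof -
  have "(\<lambda>n. x ^ n / fact n) sums exp x"
    using exp_converges[of x] by (simp add: scaleR_conv_of_real divide_inverse mult.commute)
  hence sm: "summable (\<lambda>n. x ^ n / fact n)" and eq: "(\<Sum>n. x ^ n / fact n) = exp x"
    by (auto simp: sums_iff)
  show ?thesis
    unfolding eq[symmetric] by (rule sum_le_suminf[OF sm]) (use assms in auto)
qed

text \<open>Cauchy-Schwarz with coefficients normalised by the monomial norms. The index set is
  arbitrary because, besides full evaluation, the block of degrees lost in a truncation must be
  bounded.\<close>

lemma fock_partial_eval:
  assumes s: "s > 0" and J: "finite J"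
  shows "cmod (\<Sum>j\<in>J. coeff f j * z ^ j) \<le> fock_norm s f * sqrt (s * (\<Sum>j\<in>J. (s * (cmod z)^2) ^ j / fact j))"
proof -
  obtain M where M: "degree f < M" "J \<subseteq> {..<M}"
  proof
    show "degree f < Suc (max (degree f) (Max (insert 0 J)))" by auto
    show "J \<subseteq> {..<Suc (max (degree f) (Max (insert 0 J)))}"
    proof
      fix x assume "x \<in> J"
      hence "x \<le> Max (insert 0 J)" using J by (intro Max_ge) auto
      thus "x \<in> {..<Suc (max (degree f) (Max (insert 0 J)))}" by auto
    qed
  qed
  define a where "a j = cmod (coeff f j) * sqrt (fact j / s ^ (j + 1))" for j
  define b where "b j = cmod z ^ j * sqrt (s ^ (j + 1) / fact j)" for j
  have ab: "a j * b j = cmod (coeff f j * z ^ j)" for j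
  proof -
    have "sqrt (fact j / s ^ (j + 1)) * sqrt (s ^ (j + 1) / fact j) = 1"
      using s by (simp flip: real_sqrt_mult)
    thus ?thesis by (simp add: a_def b_def norm_mult norm_power algebra_simps)
  qed
  have "cmod (\<Sum>j\<in>J. coeff f j * z ^ j) \<le> (\<Sum>j\<in>J. a j * b j)"
    unfolding ab by (rule norm_sum)
  also have "\<dots> \<le> sqrt ((\<Sum>j\<in>J. (a j)^2) * (\<Sum>j\<in>J. (b j)^2))"
    by (rule real_le_rsqrt) (rule Cauchy_Schwarz_ineq_sum)
  also have "\<dots> = sqrt (\<Sum>j\<in>J. (a j)^2) * sqrt (\<Sum>j\<in>J. (b j)^2)" by (rule real_sqrt_mult)
  also have "\<dots> \<le> fock_norm s f * sqrt (s * (\<Sum>j\<in>J. (s * (cmod z)^2) ^ j / fact j))"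
  proof (intro mult_mono)
    have "(\<Sum>j\<in>J. (a j)^2) \<le> (\<Sum>j<M. (a j)^2)" using M by (intro sum_mono2) auto
    also have "\<dots> = (fock_norm s f)^2"
      unfolding fock_norm_square[OF M(1) s] a_def using s by (simp add: power_mult_distrib)
    finally show "sqrt (\<Sum>j\<in>J. (a j)^2) \<le> fock_norm s f"
      using fock_norm_nonneg[OF s, of f] by (simp add: real_le_lsqrt)
    have "(b j)^2 = s * ((s * (cmod z)^2) ^ j / fact j)" for j
      using s by (simp add: b_def power_mult_distrib power_mult[symmetric] mult.commute)
    thus "sqrt (\<Sum>j\<in>J. (b j)^2) \<le> sqrt (s * (\<Sum>j\<in>J. (s * (cmod z)^2) ^ j / fact j))"
      by (simp add: sum_distrib_left)
  qed (auto intro!: fock_norm_nonneg sum_nonneg s)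
  finally show ?thesis .
qed

lemma fock_eval_lessThan:
  assumes s: "s > 0" and M: "degree f < M"
  shows "cmod (poly f z) \<le> fock_norm s f * sqrt (s * (\<Sum>j<M. (s * (cmod z)^2) ^ j / fact j))"
  unfolding poly_eq_sum_lessThan[OF M] by (rule fock_partial_eval[OF s]) simp

lemma fock_eval:
  assumes s: "s > 0"
  shows "cmod (poly f z) \<le> fock_norm s f * (sqrt s * exp (s * (cmod z)^2 / 2))"
proof -
  have "cmod (poly f z) \<le> fock_norm s f * sqrt (s * (\<Sum>j<Suc (degree f). (s * (cmod z)^2) ^ j / fact j))"
    by (rule fock_eval_lessThan[OF s]) simp
  also have "\<dots> \<le> fock_norm s f * sqrt (s * exp (s * (cmod z)^2))"
    using s by (intro mult_left_mono real_sqrt_le_mono sum_power_fact_le_exp fock_norm_nonneg) auto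
  also have "sqrt (s * exp (s * (cmod z)^2)) = sqrt s * exp (s * (cmod z)^2 / 2)"
    by (rule real_sqrt_unique) (use s in \<open>auto simp: power_mult_distrib exp_double[symmetric]\<close>)
  finally show ?thesis .
qed

text \<open>The rate \<open>r^2 - 1 - 2 * ln r\<close> is the excess of \<open>|z|^2\<close> over
  the growth \<open>1 + 2 * ln |z|\<close> open to polynomials of degree \<open>N\<close>, taken at
  radius \<open>r\<close>. The factor \<open>r ^ (2 * m)\<close> pays for \<open>m\<close> extra
  degrees, \<open>exp (r^2)\<close> for the Gaussian split off in \<open>fock_tail\<close>.\<close>

definition tail_const :: "real \<Rightarrow> nat \<Rightarrow> nat \<Rightarrow> real" where
  "tail_const r m N = real N * r ^ (2 * m) * exp (- real N * (r\<^sup>2 - 1 - 2 * ln r)) * exp (r\<^sup>2)"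

lemma tail_const_nonneg: "r > 0 \<Longrightarrow> tail_const r m N \<ge> 0"
  by (simp add: tail_const_def)

lemma square_minus_ln_pos:
  assumes "r > (1::real)"
  shows "r\<^sup>2 - 1 - 2 * ln r > 0"
proof -
  have "2 * ln r = ln (r\<^sup>2)" using assms by (simp add: ln_realpow)
  moreover have "ln (r\<^sup>2) < r\<^sup>2 - 1"
    using assms ln_le_minus_one[of "r\<^sup>2"] ln_eq_minus_one[of "r\<^sup>2"] by (fastforce simp: power2_eq_1_iff)
  ultimately show ?thesis by simp
qed

lemma tail_const_tendsto_0:
  assumes "r > 1"
  shows "tail_const r m \<longlonglongrightarrow> 0"
proof -
  have "(\<lambda>N. real N * exp (- real N * b)) \<longlonglongrightarrow> 0" if "b > 0" for b :: real
    using that by real_asymp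
  from this[OF square_minus_ln_pos[OF assms]]
  have "(\<lambda>N. r ^ (2 * m) * exp (r\<^sup>2) * (real N * exp (- real N * (r\<^sup>2 - 1 - 2 * ln r)))) \<longlonglongrightarrow> r ^ (2 * m) * exp (r\<^sup>2) * 0"
    by (intro tendsto_intros)
  thus ?thesis by (simp add: tail_const_def[abs_def] mult_ac)
qed

text \<open>Point evaluation combined with a Chernoff bound of the truncated exponential. A factor
  \<open>exp (- (cmod z)^2)\<close> is kept on the right so that the bound can be integrated over
  the exterior, also against a further weight.\<close>

lemma fock_tail:
  assumes N: "real N * (1 - 1 / r\<^sup>2) \<ge> 1" and r: "r > 1" and deg: "degree f < N + m" and z: "cmod z \<ge> r"
  shows "(cmod (poly f z))^2 * exp (- real N * (cmod z)^2) \<le> (fock_norm N f)^2 * tail_const r m N * exp (- ((cmod z)^2))"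
proof -
  have N0: "real N > 0" using N by (cases "N = 0") auto
  define x where "x = real N * (cmod z)^2"
  have x: "x \<ge> 0" by (simp add: x_def)
  have "(cmod (poly f z))^2 \<le> (fock_norm N f * sqrt (N * (\<Sum>j<N + m. x ^ j / fact j)))^2"
    unfolding x_def by (intro power_mono fock_eval_lessThan N0 deg) simp
  also have "\<dots> = (fock_norm N f)^2 * N * (\<Sum>j<N + m. x ^ j / fact j)"
    using x by (simp add: power_mult_distrib sum_nonneg)
  \<comment> \<open>All degrees are below \<open>N + m\<close> and \<open>r > 1\<close>, so
    rescaling \<open>x\<close> by \<open>r^2\<close> costs at most \<open>r ^ (2 * (N + m))\<close>
    and improves \<open>exp x\<close> to \<open>exp (x / r^2)\<close>.\<close>
  also have "(\<Sum>j<N + m. x ^ j / fact j) \<le> (\<Sum>j<N + m. (r\<^sup>2) ^ (N + m) * ((x / r\<^sup>2) ^ j / fact j))"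
  proof (rule sum_mono)
    fix j assume "j \<in> {..<N + m}"
    hence "(r\<^sup>2) ^ j \<le> (r\<^sup>2) ^ (N + m)" using r by (intro power_increasing) auto
    hence "(r\<^sup>2) ^ j * ((x / r\<^sup>2) ^ j / fact j) \<le> (r\<^sup>2) ^ (N + m) * ((x / r\<^sup>2) ^ j / fact j)"
      using x by (intro mult_right_mono) auto
    thus "x ^ j / fact j \<le> (r\<^sup>2) ^ (N + m) * ((x / r\<^sup>2) ^ j / fact j)"
      using r by (simp add: power_divide)
  qed
  also have "\<dots> \<le> (r\<^sup>2) ^ (N + m) * exp (x / r\<^sup>2)"
    unfolding sum_distrib_left[symmetric] using x by (intro mult_left_mono sum_power_fact_le_exp) auto
  finally have "(cmod (poly f z))^2 \<le> (fock_norm N f)^2 * N * ((r\<^sup>2) ^ (N + m) * exp (x / r\<^sup>2))"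
    using N0 by (simp add: mult_left_mono)
  hence "(cmod (poly f z))^2 * exp (- x) \<le> (fock_norm N f)^2 * N * ((r\<^sup>2) ^ (N + m) * exp (x / r\<^sup>2)) * exp (- x)"
    by (intro mult_right_mono) auto
  also have "\<dots> = (fock_norm N f)^2 * N * r ^ (2 * m) * (r ^ (2 * N) * exp (x / r\<^sup>2 - x))"
    by (simp add: power_add power_mult power_even_eq exp_diff exp_minus field_simps flip: power_mult)
  also have "\<dots> \<le> (fock_norm N f)^2 * N * r ^ (2 * m) * (exp (- real N * (r\<^sup>2 - 1 - 2 * ln r)) * exp (r\<^sup>2) * exp (- ((cmod z)^2)))"
  proof (rule mult_left_mono)
    \<comment> \<open>The assumption on \<open>N\<close> says that \<open>x - x / r^2\<close> grows
      at least at unit rate in \<open>(cmod z)^2\<close>; past the radius \<open>r\<close> this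
      surplus supplies the Gaussian factor.\<close>
    have "1 * ((cmod z)^2 - r\<^sup>2) \<le> (real N * (1 - 1 / r\<^sup>2)) * ((cmod z)^2 - r\<^sup>2)"
      using N z r by (intro mult_right_mono) (auto intro: power_mono)
    also have "\<dots> = x - x / r\<^sup>2 - real N * (r\<^sup>2 - 1)"
      using r by (simp add: x_def field_simps)
    finally have *: "2 * real N * ln r + (x / r\<^sup>2 - x) \<le> - real N * (r\<^sup>2 - 1 - 2 * ln r) + r\<^sup>2 + (- ((cmod z)^2))"
      by (simp add: algebra_simps)
    have "r ^ (2 * N) = exp (2 * real N * ln r)"
      using r by (simp add: powr_realpow[symmetric] powr_def)
    moreover have "exp (2 * real N * ln r) * exp (x / r\<^sup>2 - x) \<le> exp (- real N * (r\<^sup>2 - 1 - 2 * ln r)) * exp (r\<^sup>2) * exp (- ((cmod z)^2))"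
      unfolding exp_add[symmetric] using * by simp
    ultimately show "r ^ (2 * N) * exp (x / r\<^sup>2 - x) \<le> exp (- real N * (r\<^sup>2 - 1 - 2 * ln r)) * exp (r\<^sup>2) * exp (- ((cmod z)^2))"
      by simp
  qed (use r in auto)
  also have "\<dots> = (fock_norm N f)^2 * tail_const r m N * exp (- ((cmod z)^2))"
    by (simp add: tail_const_def mult_ac)
  finally show ?thesis by (simp add: x_def)
qed

text \<open>The Ginibre kernel without its weight, as a polynomial in the first variable: the
  reproducing kernel of the polynomials of degree below \<open>n\<close> for the Gaussian of
  parameter \<open>s\<close>. The parameters are separate because the cutoff will also be
  \<open>N - m\<close> while \<open>s\<close> stays \<open>N\<close>.\<close>

definition ginibre_poly :: "nat \<Rightarrow> real \<Rightarrow> complex \<Rightarrow> complex poly" where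
  "ginibre_poly n s w = (\<Sum>j<n. monom (of_real (s ^ (j + 1) / fact j) * cnj w ^ j) j)"

lemma coeff_ginibre_poly:
  "coeff (ginibre_poly n s w) j = (if j < n then of_real (s ^ (j + 1) / fact j) * cnj w ^ j else 0)"
  by (simp add: ginibre_poly_def coeff_sum)

lemma poly_ginibre_poly:
  "poly (ginibre_poly n s w) z = of_real s * (\<Sum>j<n. (of_real s * z * cnj w) ^ j / fact j)"
  by (simp add: ginibre_poly_def poly_sum poly_monom sum_distrib_left power_mult_distrib mult_ac)

lemma degree_ginibre_poly:
  assumes "n > 0"
  shows "degree (ginibre_poly n s w) < n"
  using assms by (intro degree_lessI) (auto simp: coeff_ginibre_poly)

text \<open>The degree of \<open>f\<close> is not restricted: orthogonality of monomials makes the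
  pairing return the truncation of \<open>f\<close> to degrees below \<open>n\<close>. This is
  needed for products \<open>T' * h\<close>, which may exceed the cutoff.\<close>

lemma ginibre_reproducing:
  assumes s: "s > 0" and n: "n > 0"
  shows "has_bochner_integral lborel (\<lambda>z. poly f z * cnj (poly (ginibre_poly n s w) z) * of_real (exp (- s * (cmod z)^2) / pi))
           (\<Sum>j<n. coeff f j * w ^ j)"
proof -
  define M where "M = Suc (max (degree f) n)"
  have M: "degree f < M" "n \<le> M" by (auto simp: M_def)
  have "degree (ginibre_poly n s w) < M" using degree_ginibre_poly[OF n] M(2) by (rule less_le_trans)
  from gauss_inner_polys[OF s M(1) this]
  have "has_bochner_integral lborel (\<lambda>z. poly f z * cnj (poly (ginibre_poly n s w) z) * of_real (exp (- s * (cmod z)^2) / pi))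
           (\<Sum>j<M. coeff f j * cnj (coeff (ginibre_poly n s w) j) * of_real (fact j / s ^ (j + 1)))" .
  also have "(\<Sum>j<M. coeff f j * cnj (coeff (ginibre_poly n s w) j) * of_real (fact j / s ^ (j + 1)))
       = (\<Sum>j<n. coeff f j * w ^ j)"
    using s M by (intro sum.mono_neutral_cong_right) (auto simp: coeff_ginibre_poly)
  finally show ?thesis .
qed

lemma fock_norm_ginibre_poly:
  assumes s: "s > 0"
  shows "fock_norm s (ginibre_poly n s w) \<le> sqrt s * exp (s * (cmod w)^2 / 2)"
proof (cases "n = 0")
  case True
  thus ?thesis using s by (simp add: ginibre_poly_def fock_norm_def)
next
  case False
  hence n: "n > 0" by simp
  have "(fock_norm s (ginibre_poly n s w))^2 = (\<Sum>j<n. s * ((s * (cmod w)^2) ^ j / fact j))"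
    unfolding fock_norm_square[OF degree_ginibre_poly[OF n] s]
    using s by (intro sum.cong refl)
      (simp add: coeff_ginibre_poly norm_mult norm_power norm_divide power_mult_distrib power2_eq_square power_mult field_simps)
  also have "\<dots> \<le> s * exp (s * (cmod w)^2)"
    unfolding sum_distrib_left[symmetric] using s by (intro mult_left_mono sum_power_fact_le_exp) auto
  also have "\<dots> = (sqrt s * exp (s * (cmod w)^2 / 2))^2"
    using s by (simp add: power_mult_distrib exp_double[symmetric])
  finally show ?thesis by (rule power2_le_imp_le) (use s in auto)
qed

section \<open>Sections of the exponential series\<close>

text \<open>The Poisson probability of the value \<open>n\<close> at mean \<open>n\<close>. It is
  the maximum of \<open>x ^ n * exp (- x) / fact n\<close> over \<open>x >= 0\<close>, hence bounds
  the share of one degree in the exponential series.\<close>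

definition poisson_mode :: "nat \<Rightarrow> real" where
  "poisson_mode n = real n ^ n * exp (- real n) / fact n"

lemma poisson_mode_pos: "n > 0 \<Longrightarrow> poisson_mode n > 0"
  by (simp add: poisson_mode_def)

text \<open>The ratio of consecutive modes is \<open>(1 + 1 / n) ^ n / exp 1\<close>, at most
  1.\<close>

lemma poisson_mode_Suc_le:
  assumes "n > 0"
  shows "poisson_mode (Suc n) \<le> poisson_mode n"
proof -
  have "(1 + 1 / real n) ^ n \<le> exp (1 / real n) ^ n"
    using assms by (intro power_mono exp_ge_add_one_self) auto
  also have "\<dots> = exp 1" using assms by (simp add: exp_of_nat_mult[symmetric])
  finally have "(real n * (1 + 1 / real n)) ^ n \<le> real n ^ n * exp 1"
    unfolding power_mult_distrib by (intro mult_left_mono) auto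
  also have "real n * (1 + 1 / real n) = real (Suc n)" using assms by (simp add: field_simps)
  finally have "real (Suc n) ^ n * exp (- real (Suc n)) / fact n \<le> real n ^ n * exp 1 * exp (- real (Suc n)) / fact n"
    by (intro divide_right_mono mult_right_mono) auto
  also have "\<dots> = poisson_mode n"
    by (simp add: poisson_mode_def exp_add[symmetric])
  also have "real (Suc n) ^ n * exp (- real (Suc n)) / fact n = poisson_mode (Suc n)"
    by (simp add: poisson_mode_def divide_simps del: of_nat_Suc)
  finally show ?thesis .
qed

lemma poisson_mode_antimono:
  assumes "n \<le> j" "0 < n"
  shows "poisson_mode j \<le> poisson_mode n"
  using assms
proof (induction j rule: dec_induct)
  case (step j)
  thus ?case using poisson_mode_Suc_le[of j] by simp
qed simp

text \<open>This is \<open>y <= exp (y - 1)\<close> at \<open>y = x / n\<close>, raised to the power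
  \<open>n\<close>.\<close>

lemma poisson_le_mode:
  assumes "x \<ge> 0" "n > 0"
  shows "x ^ n / fact n \<le> poisson_mode n * exp x"
proof -
  have "x / real n \<le> exp (x / real n - 1)" using exp_ge_add_one_self[of "x / real n - 1"] by simp
  hence "(x / real n) ^ n \<le> exp (x / real n - 1) ^ n" using assms by (intro power_mono) auto
  also have "\<dots> = exp (x - real n)" using assms by (simp add: exp_of_nat_mult[symmetric] algebra_simps)
  finally have "x ^ n \<le> real n ^ n * exp (x - real n)"
    using assms by (simp add: power_divide field_simps)
  thus ?thesis by (simp add: poisson_mode_def exp_diff exp_minus field_simps)
qed

text \<open>For real \<open>x >= 0\<close> this is the probability that a Poisson variable of mean
  \<open>x\<close> is at most \<open>n\<close>. The last index is included, so a kernel of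
  \<open>N\<close> terms corresponds to \<open>expsec (N - 1)\<close>. The type is generic because
  the constants are found on the real line while the limit is needed at complex arguments.\<close>

definition expsec :: "nat \<Rightarrow> 'a :: {real_normed_field, banach} \<Rightarrow> 'a" where
  "expsec n x = exp (- x) * (\<Sum>j\<le>n. x ^ j / fact j)"

lemma expsec_has_field_derivative:
  fixes x :: "'a :: {real_normed_field, banach}"
  shows "(expsec n has_field_derivative - (exp (- x) * x ^ n / fact n)) (at x)"
proof -
  have *: "((\<lambda>x::'a. \<Sum>j\<le>n. x ^ j / fact j) has_field_derivative ((\<Sum>j\<le>n. x ^ j / fact j) - x ^ n / fact n)) (at x)"
  proof (induction n)
    case (Suc n)
    have "((\<lambda>x::'a. x ^ Suc n / fact (Suc n)) has_field_derivative (x ^ n / fact n)) (at x)"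
    proof -
      have "((\<lambda>x::'a. x ^ Suc n / fact (Suc n)) has_field_derivative (of_nat (Suc n) * x ^ n / fact (Suc n))) (at x)"
        by (intro DERIV_cdivide) (rule derivative_eq_intros refl | simp del: of_nat_Suc power_Suc)+
      also have "of_nat (Suc n) * x ^ n / fact (Suc n) = x ^ n / fact n"
        by (simp add: divide_simps del: of_nat_Suc)
      finally show ?thesis .
    qed
    from DERIV_add[OF Suc this] show ?case by simp
  qed simp
  show ?thesis unfolding expsec_def
    by (rule derivative_eq_intros * refl)+ (simp add: algebra_simps)
qed

text \<open>The Poisson term \<open>x ^ n * exp (- x) / fact n\<close> at
  \<open>x = n + sqrt (2 * n) * v\<close>, divided by its value at \<open>v = 0\<close>.\<close>

definition gauss_approx :: "nat \<Rightarrow> 'a :: {real_normed_field, banach} \<Rightarrow> 'a" where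
  "gauss_approx n v = (1 + of_real (sqrt (2 / real n)) * v) ^ n * exp (- of_real (sqrt (2 * real n)) * v)"

text \<open>The derivative of the remainder is \<open>z ^ 2 / (1 + z)\<close>, and
  \<open>Re (1 + z) >= 1 / 2\<close> bounds it by \<open>2 * (cmod s)^2\<close> on the ball of
  radius \<open>cmod s\<close>.\<close>

lemma cmod_Ln_quadratic:
  assumes "cmod s \<le> 1 / 2"
  shows "cmod (Ln (1 + s) - s + s ^ 2 / 2) \<le> 2 * cmod s ^ 3"
proof -
  define f where "f s = Ln (1 + s) - s + s ^ 2 / 2" for s :: complex
  have "cmod (f s - f 0) \<le> (2 * (cmod s)^2) * cmod (s - 0)"
  proof (rule field_differentiable_bound[where S = "cball 0 (cmod s)"])
    fix z :: complex assume "z \<in> cball 0 (cmod s)"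
    hence z: "cmod z \<le> cmod s" by simp
    with assms have z2: "cmod z \<le> 1 / 2" by linarith
    have re: "Re (1 + z) \<ge> 1 / 2" using abs_Re_le_cmod[of z] z2 by simp
    hence nn: "1 + z \<notin> \<real>\<^sub>\<le>\<^sub>0" by (auto simp: complex_nonpos_Reals_iff)
    hence "1 + z \<noteq> 0" by auto
    hence eq: "1 / (1 + z) - 1 + z = z ^ 2 / (1 + z)" by (simp add: field_simps power2_eq_square)
    have "(f has_field_derivative (1 / (1 + z) - 1 + z)) (at z within cball 0 (cmod s))"
      unfolding f_def[abs_def] using nn by (auto intro!: derivative_eq_intros simp: inverse_eq_divide)
    thus "(f has_field_derivative (z ^ 2 / (1 + z))) (at z within cball 0 (cmod s))" by (simp only: eq)
    have "1 / 2 \<le> cmod (1 + z)" using re complex_Re_le_cmod[of "1 + z"] by linarith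
    hence "cmod (z ^ 2 / (1 + z)) \<le> (cmod s)^2 / (1 / 2)"
      unfolding norm_divide norm_power using z by (intro frac_le power_mono) auto
    thus "cmod (z ^ 2 / (1 + z)) \<le> 2 * (cmod s)^2" by simp
  qed auto
  thus ?thesis by (simp add: f_def power3_eq_cube power2_eq_square mult_ac)
qed

lemma gauss_approx_eq:
  fixes v :: complex
  assumes n: "n > 0" and small: "sqrt (2 / real n) * cmod v \<le> 1 / 2"
  obtains h where "gauss_approx n v = exp (- (v ^ 2)) * exp h" "cmod h \<le> 4 * cmod v ^ 3 * sqrt (2 / real n)"
proof
  \<comment> \<open>Since \<open>n * q^2 = 2\<close>, with \<open>s = q * v\<close> the quadratic
    term of \<open>n * Ln (1 + s)\<close> is exactly \<open>- (v ^ 2)\<close>, the linear one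
    cancels the exponential factor, and \<open>h\<close> is the cubic remainder.\<close>
  define q where "q = sqrt (2 / real n)"
  have nq2: "real n * q\<^sup>2 = 2" and nq: "real n * q = sqrt (2 * real n)" and q0: "q > 0"
    using n by (auto simp: q_def real_sqrt_divide real_sqrt_mult field_simps)
  have nqc: "of_nat n * (of_real q)\<^sup>2 = (2::complex)"
    by (metis nq2 of_real_mult of_real_numeral of_real_of_nat_eq of_real_power)
  define s where "s = of_real q * v"
  have ms: "cmod s = q * cmod v" using q0 by (simp add: s_def norm_mult)
  have s2: "cmod s \<le> 1 / 2" using small by (simp add: ms q_def)
  define h where "h = of_nat n * (Ln (1 + s) - s + s ^ 2 / 2)"
  have "Re (1 + s) > 0" using abs_Re_le_cmod[of s] s2 by simp
  hence "1 + s \<noteq> 0" by (metis less_irrefl zero_complex.simps(1))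
  hence "(1 + s) ^ n = exp (of_nat n * Ln (1 + s))" by (simp add: exp_of_nat_mult)
  moreover have "of_nat n * s ^ 2 / 2 = v ^ 2"
    using nqc by (simp add: s_def power_mult_distrib)
  moreover have "of_real (sqrt (2 * real n)) * v = of_nat n * s"
    unfolding s_def nq[symmetric] by simp
  ultimately show "gauss_approx n v = exp (- (v ^ 2)) * exp h"
    unfolding gauss_approx_def h_def q_def[symmetric] s_def[symmetric]
    by (simp add: exp_add[symmetric] algebra_simps)
  have "cmod h \<le> real n * (2 * cmod s ^ 3)"
    unfolding h_def norm_mult using cmod_Ln_quadratic[OF s2] by (simp add: mult_left_mono)
  also have "\<dots> = 2 * cmod v ^ 3 * (real n * q\<^sup>2) * q"
    by (simp add: ms power_mult_distrib power3_eq_cube power2_eq_square)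
  finally show "cmod h \<le> 4 * cmod v ^ 3 * sqrt (2 / real n)" unfolding nq2 by (simp add: q_def)
qed

lemma gauss_approx_uniform_limit:
  "uniform_limit (cball 0 R) gauss_approx (\<lambda>v::complex. exp (- (v ^ 2))) sequentially"
proof (cases "R \<ge> 0")
  case True
  have lim0: "(\<lambda>n. 4 * R ^ 3 * sqrt (2 / real n)) \<longlonglongrightarrow> 0" "(\<lambda>n. sqrt (2 / real n) * R) \<longlonglongrightarrow> 0"
    by real_asymp+
  \<comment> \<open>Uniform convergence needs a total function, so the remainder is selected by
    choice where the expansion applies and set to 0 elsewhere; for large \<open>n\<close> the
    expansion applies on the whole ball.\<close>
  define h where "h n v = (if n > 0 \<and> sqrt (2 / real n) * cmod v \<le> 1 / 2 then
     (SOME h. gauss_approx n v = exp (- (v ^ 2)) * exp h \<and> cmod h \<le> 4 * cmod v ^ 3 * sqrt (2 / real n)) else 0)" for n and v :: complex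
  have h: "gauss_approx n v = exp (- (v ^ 2)) * exp (h n v) \<and> cmod (h n v) \<le> 4 * cmod v ^ 3 * sqrt (2 / real n)"
    if "n > 0" "sqrt (2 / real n) * cmod v \<le> 1 / 2" for n v
  proof -
    have "\<exists>h. gauss_approx n v = exp (- (v ^ 2)) * exp h \<and> cmod h \<le> 4 * cmod v ^ 3 * sqrt (2 / real n)"
      using gauss_approx_eq[OF that] by metis
    from someI_ex[OF this] show ?thesis using that by (simp add: h_def)
  qed
  have ev: "\<forall>\<^sub>F n in sequentially. n > 0 \<and> sqrt (2 / real n) * R < 1 / 2"
    by (intro eventually_conj eventually_gt_at_top order_tendstoD(2)[OF lim0(2)]) simp
  have ev2: "\<forall>\<^sub>F n in sequentially. \<forall>v\<in>cball 0 R. gauss_approx n v = exp (- (v ^ 2)) * exp (h n v) \<and> cmod (h n v) \<le> 4 * R ^ 3 * sqrt (2 / real n)"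
    using ev
  proof (eventually_elim, intro ballI)
    fix n :: nat and v :: complex assume n: "n > 0 \<and> sqrt (2 / real n) * R < 1 / 2" and v: "v \<in> cball 0 R"
    have "sqrt (2 / real n) * cmod v \<le> sqrt (2 / real n) * R" using v by (intro mult_left_mono) auto
    with n have "sqrt (2 / real n) * cmod v \<le> 1 / 2" by linarith
    from h[OF _ this] n have 1: "gauss_approx n v = exp (- (v ^ 2)) * exp (h n v)" and 2: "cmod (h n v) \<le> 4 * cmod v ^ 3 * sqrt (2 / real n)" by auto
    have "cmod v ^ 3 \<le> R ^ 3" using v by (intro power_mono) auto
    hence "4 * cmod v ^ 3 * sqrt (2 / real n) \<le> 4 * R ^ 3 * sqrt (2 / real n)" by (intro mult_right_mono) auto
    with 1 2 show "gauss_approx n v = exp (- (v ^ 2)) * exp (h n v) \<and> cmod (h n v) \<le> 4 * R ^ 3 * sqrt (2 / real n)" by linarith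
  qed
  have "uniform_limit (cball 0 R) h (\<lambda>_. 0) sequentially"
  proof (rule uniform_limitI)
    fix e :: real assume "e > 0"
    show "\<forall>\<^sub>F n in sequentially. \<forall>x\<in>cball 0 R. dist (h n x) 0 < e"
      using ev2 order_tendstoD(2)[OF lim0(1) \<open>e > 0\<close>] by eventually_elim force
  qed
  hence "uniform_limit (cball 0 R) (\<lambda>n v. exp (h n v)) (\<lambda>_. exp 0) sequentially"
  proof (rule uniform_limit_compose_uniformly_continuous_on)
    show "uniformly_continuous_on (cball 0 1) (exp :: complex \<Rightarrow> complex)"
      by (intro compact_uniformly_continuous continuous_intros) auto
    show "\<forall>\<^sub>F n in sequentially. \<forall>y\<in>cball 0 R. h n y \<in> cball 0 1"
      using ev2 order_tendstoD(2)[OF lim0(1) zero_less_one] by eventually_elim force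
  qed auto
  hence "uniform_limit (cball 0 R) (\<lambda>n v. exp (- (v ^ 2)) * exp (h n v)) (\<lambda>v. exp (- (v ^ 2)) * exp 0) sequentially"
    by (intro uniform_lim_mult uniform_limit_const compact_imp_bounded compact_continuous_image continuous_intros) auto
  moreover have "\<forall>\<^sub>F n in sequentially. \<forall>v\<in>cball 0 R. exp (- (v ^ 2)) * exp (h n v) = gauss_approx n v"
    using ev2 by eventually_elim auto
  ultimately show ?thesis by (subst (asm) uniform_limit_cong) auto
qed auto

text \<open>The gain over \<open>s\<close> is quadratic near 0 and linear for large
  \<open>s\<close>; multiplied by \<open>n\<close> and rescaled it still yields a majorant
  independent of \<open>n\<close>. For negative \<open>s\<close> the stronger gain
  \<open>s^2 / 2\<close> is available.\<close>

lemma ln_one_plus_le: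
  assumes "s > (-1::real)"
  shows "ln (1 + s) \<le> s - s\<^sup>2 / (2 * (1 + \<bar>s\<bar>))"
proof (cases "s \<ge> 0")
  case True
  define k where "k s = s - s\<^sup>2 / (2 * (1 + s)) - ln (1 + s)" for s :: real
  have "k 0 \<le> k s"
  proof (rule DERIV_nonneg_imp_nondecreasing[OF True])
    fix x assume x: "0 \<le> x" "x \<le> s"
    have "(k has_real_derivative (x\<^sup>2 / (2 * (1 + x)\<^sup>2))) (at x)"
      unfolding k_def[abs_def] using x
      by - ((rule derivative_eq_intros refl | force)+, simp add: divide_simps, simp add: algebra_simps power2_eq_square)
    thus "\<exists>y. (k has_real_derivative y) (at x) \<and> y \<ge> 0" by (intro exI conjI) auto
  qed
  thus ?thesis using True by (simp add: k_def)
next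
  case False
  define k where "k s = s - s\<^sup>2 / 2 - ln (1 + s)" for s :: real
  have "k 0 \<le> k s"
  proof (rule DERIV_nonpos_imp_nonincreasing[of s 0])
    fix x assume x: "s \<le> x" "x \<le> 0"
    have "(k has_real_derivative (- (x\<^sup>2 / (1 + x)))) (at x)"
      unfolding k_def[abs_def] using x assms
      by (auto intro!: derivative_eq_intros simp: divide_simps) (simp add: algebra_simps power2_eq_square)
    thus "\<exists>y. (k has_real_derivative y) (at x) \<and> y \<le> 0" using x assms by (intro exI[of _ "- (x\<^sup>2 / (1 + x))"] conjI) auto
  qed (use False in auto)
  hence "ln (1 + s) \<le> s - s\<^sup>2 / 2" by (simp add: k_def)
  moreover have "s\<^sup>2 / (2 * (1 + \<bar>s\<bar>)) \<le> s\<^sup>2 / 2" by (intro divide_left_mono) auto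
  ultimately show ?thesis by linarith
qed

section \<open>Gaussian integrals on the real line and the Stirling constant\<close>

lemma gauss_approx_real:
  "gauss_approx n (v :: real) = (1 + sqrt (2 / real n) * v) ^ n * exp (- sqrt (2 * real n) * v)"
  by (simp add: gauss_approx_def)

lemma gauss_approx_of_real: "gauss_approx n (complex_of_real v) = of_real (gauss_approx n v)"
  by (simp add: gauss_approx_def flip: exp_of_real)

lemma gauss_approx_real_tendsto: "(\<lambda>n. gauss_approx n (v :: real)) \<longlonglongrightarrow> exp (- v\<^sup>2)"
proof -
  have "(\<lambda>n. gauss_approx n (complex_of_real v)) \<longlonglongrightarrow> exp (- (of_real v ^ 2))"
    by (rule tendsto_uniform_limitI[OF gauss_approx_uniform_limit[of "\<bar>v\<bar>"]]) simp
  also have "exp (- (of_real v ^ 2)) = complex_of_real (exp (- v\<^sup>2))" by (simp flip: exp_of_real)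
  finally show ?thesis unfolding gauss_approx_of_real by (simp only: tendsto_of_real_iff)
qed

text \<open>The upper bound is the majorant for dominated convergence. The condition on
  \<open>v\<close> means \<open>x >= 0\<close> for \<open>x = n + sqrt (2 * n) * v\<close>. The tail
  is exponential rather than Gaussian because for \<open>n = 1\<close> the decay is no
  faster.\<close>

lemma gauss_approx_real_bounds:
  fixes v :: real
  assumes n: "n > 0" and v: "1 + sqrt (2 / real n) * v \<ge> 0"
  shows "0 \<le> gauss_approx n v" "gauss_approx n v \<le> exp (1 / 4) * exp (- \<bar>v\<bar> / 2)"
proof -
  show "0 \<le> gauss_approx n v" using v by (simp add: gauss_approx_real)
  show "gauss_approx n v \<le> exp (1 / 4) * exp (- \<bar>v\<bar> / 2)"
  proof (cases "1 + sqrt (2 / real n) * v = 0")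
    case True
    thus ?thesis using n by (simp add: gauss_approx_real zero_power)
  next
    case False
    define q where "q = sqrt (2 / real n)"
    have nq2: "real n * q\<^sup>2 = 2" and nq: "real n * q = sqrt (2 * real n)" and q0: "q > 0"
      using n by (auto simp: q_def real_sqrt_divide real_sqrt_mult field_simps)
    have q2: "q \<le> 2" unfolding q_def using n by (intro real_le_lsqrt) (auto simp: field_simps)
    define s where "s = q * v"
    have nqv: "sqrt (2 * real n) * v = real n * s" using nq by (simp add: s_def mult.assoc[symmetric])
    have s: "s > -1" using False v by (simp add: s_def q_def)
    have "(1 + s) ^ n = exp (real n * ln (1 + s))" using s by (simp add: exp_of_nat_mult)
    hence "gauss_approx n v = exp (real n * ln (1 + s) - real n * s)"
      unfolding gauss_approx_real q_def[symmetric] s_def[symmetric] using nqv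
      by (simp add: exp_diff exp_minus divide_inverse)
    also have "\<dots> \<le> exp (1 / 4 + - \<bar>v\<bar> / 2)"
    proof (subst exp_le_cancel_iff)
      have "real n * ln (1 + s) \<le> real n * (s - s\<^sup>2 / (2 * (1 + \<bar>s\<bar>)))"
        using ln_one_plus_le[OF s] by (intro mult_left_mono) auto
      also have "\<dots> = real n * s - (real n * q\<^sup>2) * v\<^sup>2 / (2 * (1 + \<bar>s\<bar>))"
        by (simp add: s_def algebra_simps power_mult_distrib)
      also have "\<dots> = real n * s - v\<^sup>2 / (1 + \<bar>s\<bar>)"
        unfolding nq2 using mult_divide_mult_cancel_left[of 2 "v\<^sup>2" "1 + \<bar>s\<bar>"] by simp
      also have "\<bar>s\<bar> \<le> 2 * \<bar>v\<bar>" unfolding s_def abs_mult using q2 q0 by (intro mult_right_mono) auto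
      hence "v\<^sup>2 / (1 + \<bar>s\<bar>) \<ge> v\<^sup>2 / (1 + 2 * \<bar>v\<bar>)" by (intro divide_left_mono) (auto intro: mult_pos_pos add_pos_nonneg)
      hence "real n * s - v\<^sup>2 / (1 + \<bar>s\<bar>) \<le> real n * s - v\<^sup>2 / (1 + 2 * \<bar>v\<bar>)" by simp
      finally have 1: "real n * ln (1 + s) - real n * s \<le> - (v\<^sup>2 / (1 + 2 * \<bar>v\<bar>))" by simp
      \<comment> \<open>The product equals \<open>4 * v^2 - 1\<close>; dividing replaces the
        quotient by a linear function, the origin of the constants \<open>1 / 4\<close> and
        \<open>1 / 2\<close>.\<close>
      have "(1 + 2 * \<bar>v\<bar>) * (2 * \<bar>v\<bar> - 1) \<le> 4 * v\<^sup>2"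
        by (simp add: algebra_simps power2_eq_square abs_mult[symmetric])
      hence "(2 * \<bar>v\<bar> - 1) / 4 \<le> v\<^sup>2 / (1 + 2 * \<bar>v\<bar>)" by (simp add: field_simps)
      with 1 show "real n * ln (1 + s) - real n * s \<le> 1 / 4 + - \<bar>v\<bar> / 2" by simp
    qed
    finally show ?thesis by (simp only: exp_add)
  qed
qed

lemma expsec_of_real: "expsec n (complex_of_real x) = of_real (expsec n x)"
  by (simp add: expsec_def flip: exp_of_real)

lemma expsec_real_tendsto_0: "(expsec n \<longlongrightarrow> (0::real)) at_top"
proof -
  have "((\<lambda>x::real. \<Sum>j\<le>n. x ^ j / exp x / fact j) \<longlongrightarrow> (\<Sum>j\<le>n. 0 / fact j)) at_top"
    by (rule tendsto_sum, rule tendsto_divide[OF tendsto_power_div_exp_0 tendsto_const]) simp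
  moreover have "(\<Sum>j\<le>n. x ^ j / exp x / fact j) = expsec n x" for x :: real
    by (simp add: expsec_def exp_minus sum_distrib_left field_simps)
  ultimately show ?thesis by simp
qed

lemma expsec_affine_derivative_value:
  fixes v :: "'a :: {real_normed_field, banach}"
  assumes "n > 0"
  shows "exp (- (of_nat n + of_real (sqrt (2 * real n)) * v)) * (of_nat n + of_real (sqrt (2 * real n)) * v) ^ n / fact n * of_real (sqrt (2 * real n))
     = of_real (sqrt (2 * real n) * poisson_mode n) * ((1 + of_real (sqrt (2 / real n)) * v) ^ n * exp (- of_real (sqrt (2 * real n)) * v))"
proof -
  have "sqrt (2 * real n) = n * sqrt (2 / real n)"
    using assms by (simp add: real_sqrt_divide real_sqrt_mult field_simps)
  hence "of_nat n + of_real (sqrt (2 * real n)) * v = of_nat n * (1 + of_real (sqrt (2 / real n)) * v)"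
    by (simp add: algebra_simps)
  hence "(of_nat n + of_real (sqrt (2 * real n)) * v) ^ n = of_nat n ^ n * (1 + of_real (sqrt (2 / real n)) * v) ^ n"
    by (simp add: power_mult_distrib)
  thus ?thesis
    by (simp add: poisson_mode_def exp_diff exp_minus exp_of_real[symmetric] field_simps)
qed

lemma expsec_affine_deriv:
  fixes v :: "'a :: {real_normed_field, banach}"
  assumes "n > 0"
  shows "((\<lambda>v. expsec n (of_nat n + of_real (sqrt (2 * real n)) * v)) has_field_derivative
           - (of_real (sqrt (2 * real n) * poisson_mode n) * gauss_approx n v)) (at v)"
proof -
  have "((\<lambda>v. expsec n (of_nat n + of_real (sqrt (2 * real n)) * v)) has_field_derivative
         (- (exp (- (of_nat n + of_real (sqrt (2 * real n)) * v)) * (of_nat n + of_real (sqrt (2 * real n)) * v) ^ n / fact n) * of_real (sqrt (2 * real n)))) (at v)"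
    by (rule DERIV_chain2[OF expsec_has_field_derivative]) (auto intro!: derivative_eq_intros)
  also have "- (exp (- (of_nat n + of_real (sqrt (2 * real n)) * v)) * (of_nat n + of_real (sqrt (2 * real n)) * v) ^ n / fact n) * of_real (sqrt (2 * real n))
      = - (of_real (sqrt (2 * real n) * poisson_mode n) * gauss_approx n v)"
    unfolding gauss_approx_def mult_minus_left by (subst expsec_affine_derivative_value[OF assms]) simp
  finally show ?thesis .
qed

text \<open>By \<open>expsec_affine_deriv\<close> the integrand is minus the derivative of the
  section, and the section vanishes at infinity, so integration from \<open>u\<close> returns its
  value there.\<close>

lemma nn_integral_gauss_approx_real:
  fixes u :: real
  assumes n: "n > 0" and u: "1 + sqrt (2 / real n) * u \<ge> 0"
  shows "(\<integral>\<^sup>+ v. ennreal (sqrt (2 * real n) * poisson_mode n * gauss_approx n v) * indicator {u..} v \<partial>lborel) =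
           ennreal (expsec n (real n + sqrt (2 * real n) * u))"
proof -
  let ?F = "\<lambda>v. - expsec n (real n + sqrt (2 * real n) * v)"
  have "(\<integral>\<^sup>+ v. ennreal (sqrt (2 * real n) * poisson_mode n * gauss_approx n v) * indicator {u..} v \<partial>lborel) = ennreal (0 - ?F u)"
  proof (rule nn_integral_FTC_atLeast)
    show "(\<lambda>v. sqrt (2 * real n) * poisson_mode n * gauss_approx n v) \<in> borel_measurable borel"
      unfolding gauss_approx_real by measurable
    fix v assume v: "u \<le> v"
    show "DERIV ?F v :> sqrt (2 * real n) * poisson_mode n * gauss_approx n v"
      using DERIV_minus[OF expsec_affine_deriv[OF n, of v]] by simp
    have "sqrt (2 / real n) * u \<le> sqrt (2 / real n) * v" using v by (intro mult_left_mono) auto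
    hence "1 + sqrt (2 / real n) * v \<ge> 0" using u by linarith
    thus "0 \<le> sqrt (2 * real n) * poisson_mode n * gauss_approx n v"
      using poisson_mode_pos[OF n] gauss_approx_real_bounds(1)[OF n] by (intro mult_nonneg_nonneg) auto
  next
    have "filterlim (\<lambda>v. real n + sqrt (2 * real n) * v) at_top at_top"
      using n by (intro filterlim_tendsto_add_at_top[OF tendsto_const] filterlim_tendsto_pos_mult_at_top[OF tendsto_const]) (auto intro: filterlim_ident)
    from tendsto_minus[OF filterlim_compose[OF expsec_real_tendsto_0 this]]
    show "(?F \<longlongrightarrow> 0) at_top" by simp
  qed
  thus ?thesis by simp
qed

lemma integral_gauss_approx_real:
  fixes u :: real
  assumes n: "n > 0" and u: "1 + sqrt (2 / real n) * u \<ge> 0"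
  shows "sqrt (2 * real n) * poisson_mode n * (LINT v|lborel. indicator {u..} v * gauss_approx n v) = expsec n (real n + sqrt (2 * real n) * u)"
proof -
  have [measurable]: "(gauss_approx n :: real \<Rightarrow> real) \<in> borel_measurable borel"
    unfolding gauss_approx_real by measurable
  have nn: "0 \<le> sqrt (2 * real n) * poisson_mode n * (indicator {u..} v * gauss_approx n v)" for v
  proof (cases "u \<le> v")
    case True
    have "sqrt (2 / real n) * u \<le> sqrt (2 / real n) * v" using True by (intro mult_left_mono) auto
    hence "1 + sqrt (2 / real n) * v \<ge> 0" using u by linarith
    thus ?thesis
      using poisson_mode_pos[OF n] gauss_approx_real_bounds(1)[OF n] by (intro mult_nonneg_nonneg) auto
  qed auto
  have "x \<ge> 0 \<Longrightarrow> expsec n x \<ge> 0" for x :: real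
    unfolding expsec_def by (intro mult_nonneg_nonneg sum_nonneg) auto
  moreover have "real n + sqrt (2 * real n) * u = n * (1 + sqrt (2 / real n) * u)"
    using n by (simp add: real_sqrt_divide real_sqrt_mult field_simps)
  ultimately have pos: "expsec n (real n + sqrt (2 * real n) * u) \<ge> 0" using u by simp
  have "(LINT v|lborel. sqrt (2 * real n) * poisson_mode n * (indicator {u..} v * gauss_approx n v)) =
      enn2real (\<integral>\<^sup>+ v. ennreal (sqrt (2 * real n) * poisson_mode n * (indicator {u..} v * gauss_approx n v)) \<partial>lborel)"
    using nn by (intro integral_eq_nn_integral) auto
  also have "(\<integral>\<^sup>+ v. ennreal (sqrt (2 * real n) * poisson_mode n * (indicator {u..} v * gauss_approx n v)) \<partial>lborel)
     = (\<integral>\<^sup>+ v. ennreal (sqrt (2 * real n) * poisson_mode n * gauss_approx n v) * indicator {u..} v \<partial>lborel)"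
    by (intro nn_integral_cong) (auto simp: indicator_def)
  also have "\<dots> = ennreal (expsec n (real n + sqrt (2 * real n) * u))" by (rule nn_integral_gauss_approx_real[OF n u])
  finally show ?thesis using pos by simp
qed

lemma integrable_exp_abs: "integrable lborel (\<lambda>v::real. exp (1 / 4) * exp (- \<bar>v\<bar> / 2))"
proof -
  have 1: "integrable lborel (exponential_density (1 / 2))"
    using prob_space.emeasure_space_1[OF prob_space_exponential_density[of "1 / 2"]]
    by (intro integrableI_nonneg) (auto simp: emeasure_density)
  have 2: "integrable lborel (\<lambda>v. exponential_density (1 / 2) (0 + (-1) * v))"
    by (rule lborel_integrable_real_affine[OF 1]) simp
  have "integrable lborel (\<lambda>v. exp (1 / 4) * (2 * (exponential_density (1 / 2) v + exponential_density (1 / 2) (0 + (-1) * v))))"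
    using 1 2 by (intro integrable_mult_right Bochner_Integration.integrable_add)
  thus ?thesis
    by (rule Bochner_Integration.integrable_bound) (auto simp: exponential_density_def)
qed

text \<open>The lower limit may move with \<open>n\<close>, which covers two uses: the left end of
  the range, where \<open>x = 0\<close>, and the fixed point \<open>v = 0\<close>. The shift to
  \<open>Suc n\<close> avoids the index 0.\<close>

lemma gauss_approx_real_integral_tendsto:
  assumes u: "\<And>n. 1 + sqrt (2 / real (Suc n)) * u n \<ge> 0"
    and lim: "\<And>v::real. v \<noteq> 0 \<Longrightarrow> (\<lambda>n. indicator {u n..} v :: real) \<longlonglongrightarrow> indicator A v"
    and [measurable]: "A \<in> sets borel"
  shows "(\<lambda>n. LINT v|lborel. indicator {u n..} v * gauss_approx (Suc n) v) \<longlonglongrightarrow> (LINT v|lborel. indicator A v * exp (- v\<^sup>2))"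
proof (rule integral_dominated_convergence[where w = "\<lambda>v. exp (1 / 4) * exp (- \<bar>v\<bar> / 2)"])
  have [measurable]: "(gauss_approx n :: real \<Rightarrow> real) \<in> borel_measurable borel" for n
    unfolding gauss_approx_real by measurable
  show "(\<lambda>v. indicator {u n..} v * gauss_approx (Suc n) v) \<in> borel_measurable lborel" for n by measurable
  show "(\<lambda>v. indicator A v * exp (- v\<^sup>2)) \<in> borel_measurable lborel" by measurable
  show "integrable lborel (\<lambda>v::real. exp (1 / 4) * exp (- \<bar>v\<bar> / 2))" by (rule integrable_exp_abs)
  have "AE v in lborel. v \<noteq> (0::real)" by (rule AE_lborel_singleton)
  thus "AE v in lborel. (\<lambda>n. indicator {u n..} v * gauss_approx (Suc n) v) \<longlonglongrightarrow> indicator A v * exp (- v\<^sup>2)"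
    by eventually_elim (intro tendsto_mult lim LIMSEQ_Suc gauss_approx_real_tendsto)
  show "AE v in lborel. norm (indicator {u n..} v * gauss_approx (Suc n) v) \<le> exp (1 / 4) * exp (- \<bar>v\<bar> / 2)" for n
  proof (rule AE_I2)
    fix v :: real
    show "norm (indicator {u n..} v * gauss_approx (Suc n) v) \<le> exp (1 / 4) * exp (- \<bar>v\<bar> / 2)"
    proof (cases "u n \<le> v")
      case True
      have "sqrt (2 / real (Suc n)) * u n \<le> sqrt (2 / real (Suc n)) * v" using True by (intro mult_left_mono) auto
      hence "1 + sqrt (2 / real (Suc n)) * v \<ge> 0" using u[of n] by linarith
      from gauss_approx_real_bounds[OF _ this] show ?thesis by (auto simp: indicator_def)
    qed auto
  qed
qed

text \<open>Both limits come from one integral. Started at \<open>x = 0\<close>, where the section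
  is 1, it gives prefactor times \<open>A n\<close> equal to 1, while \<open>A n\<close> tends to
  \<open>sqrt pi\<close>. Started at \<open>v = 0\<close> it tends to half of
  \<open>sqrt pi\<close>, and the prefactor turns it into the section at
  \<open>x = n\<close>.\<close>

lemma stirling_mode: "(\<lambda>n. sqrt (2 * real n) * poisson_mode n) \<longlonglongrightarrow> 1 / sqrt pi"
  and expsec_real_middle: "(\<lambda>n. expsec n (real n)) \<longlonglongrightarrow> 1 / 2"
proof -
  \<comment> \<open>The lower end is the \<open>v\<close> at which
    \<open>n + sqrt (2 * n) * v\<close> vanishes, taken at the index \<open>Suc n\<close>.\<close>
  define A where "A n = (LINT v|lborel. indicator {- sqrt (real (Suc n) / 2)..} v * gauss_approx (Suc n) v)" for n
  define B where "B n = (LINT v|lborel. indicator {0::real..} v * gauss_approx (Suc n) v)" for n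
  have full: "(LINT v|lborel. indicator UNIV v * exp (- v\<^sup>2)) = sqrt pi"
    using has_bochner_integral_even_function[OF gaussian_moment_0] by (simp add: has_bochner_integral_iff)
  have half: "(LINT v|lborel. indicator {0::real..} v * exp (- v\<^sup>2)) = sqrt pi / 2"
    using gaussian_moment_0 by (simp add: has_bochner_integral_iff)
  have e: "1 + sqrt (2 / real (Suc n)) * - sqrt (real (Suc n) / 2) = 0" for n
    by (simp add: real_sqrt_divide)
  have A: "A \<longlonglongrightarrow> sqrt pi"
    unfolding A_def full[symmetric]
  proof (rule gauss_approx_real_integral_tendsto)
    show "1 + sqrt (2 / real (Suc n)) * - sqrt (real (Suc n) / 2) \<ge> 0" for n using e[of n] by simp
    fix v :: real
    have "filterlim (\<lambda>n. - sqrt (real (Suc n) / 2)) at_bot sequentially" by real_asymp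
    hence "\<forall>\<^sub>F n in sequentially. - sqrt (real (Suc n) / 2) \<le> v" by (simp add: filterlim_at_bot)
    hence "\<forall>\<^sub>F n in sequentially. indicator {- sqrt (real (Suc n) / 2)..} v = (indicator UNIV v :: real)"
      by eventually_elim auto
    thus "(\<lambda>n. indicator {- sqrt (real (Suc n) / 2)..} v :: real) \<longlonglongrightarrow> indicator UNIV v"
      by (rule tendsto_eventually)
  qed auto
  have B: "B \<longlonglongrightarrow> sqrt pi / 2"
    unfolding B_def half[symmetric] by (rule gauss_approx_real_integral_tendsto) auto
  have CA: "sqrt (2 * real (Suc n)) * poisson_mode (Suc n) * A n = 1" for n
  proof -
    have "sqrt (2 * real (Suc n)) * poisson_mode (Suc n) * A n = expsec (Suc n) (real (Suc n) + sqrt (2 * real (Suc n)) * - sqrt (real (Suc n) / 2))"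
      using e[of n] unfolding A_def by (intro integral_gauss_approx_real) auto
    also have "real (Suc n) + sqrt (2 * real (Suc n)) * - sqrt (real (Suc n) / 2) = 0"
      by (simp add: real_sqrt_mult[symmetric] del: of_nat_Suc)
    also have "expsec (Suc n) 0 = 1" by (simp add: expsec_def sum.atMost_shift)
    finally show ?thesis .
  qed
  have CB: "sqrt (2 * real (Suc n)) * poisson_mode (Suc n) * B n = expsec (Suc n) (real (Suc n))" for n
    using integral_gauss_approx_real[of "Suc n" 0] unfolding B_def by simp
  have "(\<lambda>n. 1 / A n) \<longlonglongrightarrow> 1 / sqrt pi" by (intro tendsto_divide tendsto_const A) auto
  moreover have "1 / A n = sqrt (2 * real (Suc n)) * poisson_mode (Suc n)" for n
    using CA[of n] by (metis mult_zero_right nonzero_mult_div_cancel_right zero_neq_one)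
  ultimately have C: "(\<lambda>n. sqrt (2 * real (Suc n)) * poisson_mode (Suc n)) \<longlonglongrightarrow> 1 / sqrt pi" by simp
  thus "(\<lambda>n. sqrt (2 * real n) * poisson_mode n) \<longlonglongrightarrow> 1 / sqrt pi"
    by (rule LIMSEQ_imp_Suc)
  have "(\<lambda>n. sqrt (2 * real (Suc n)) * poisson_mode (Suc n) * B n) \<longlonglongrightarrow> 1 / sqrt pi * (sqrt pi / 2)"
    by (intro tendsto_mult B C)
  thus "(\<lambda>n. expsec n (real n)) \<longlonglongrightarrow> 1 / 2"
    unfolding CB by (intro LIMSEQ_imp_Suc[of "\<lambda>n. expsec n (real n)"]) simp
qed

lemma poisson_mode_tendsto_0: "poisson_mode \<longlonglongrightarrow> 0"
proof -
  have "(\<lambda>n. (sqrt (2 * real n) * poisson_mode n) * (1 / sqrt (2 * real n))) \<longlonglongrightarrow> 1 / sqrt pi * 0"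
    by (intro tendsto_mult stirling_mode) real_asymp
  moreover have "\<forall>\<^sub>F n in sequentially. (sqrt (2 * real n) * poisson_mode n) * (1 / sqrt (2 * real n)) = poisson_mode n"
    using eventually_gt_at_top[of "0::nat"] by eventually_elim simp
  ultimately show ?thesis by (simp add: filterlim_cong)
qed

text \<open>The derivatives converge uniformly on the ball by
  \<open>gauss_approx_uniform_limit\<close> and \<open>stirling_mode\<close>; integrating along the
  segment from 0, with the value at 0 known from \<open>expsec_real_middle\<close>, recovers the
  functions.\<close>

lemma expsec_uniform_limit:
  "uniform_limit (cball 0 R) (\<lambda>n v. expsec n (of_nat n + of_real (sqrt (2 * real n)) * v)) (\<lambda>v. cerfc v / 2) sequentially"
proof (rule uniform_limitI)
  fix e :: real assume "e > 0"
  define C where "C n = sqrt (2 * real n) * poisson_mode n" for n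
  \<comment> \<open>Segments from 0 within the ball have length at most \<open>|R|\<close>, so the
    derivatives use up half of \<open>e\<close>; the other half goes to the value at 0.\<close>
  define d where "d = e / (2 * (\<bar>R\<bar> + 1))"
  have d: "d > 0" "d * \<bar>R\<bar> < e / 2" using \<open>e > 0\<close> by (auto simp: d_def field_simps)
  have "uniform_limit (cball 0 R) (\<lambda>n v::complex. of_real (C n) * gauss_approx n v) (\<lambda>v. of_real (1 / sqrt pi) * exp (- (v ^ 2))) sequentially"
  proof (intro uniform_lim_mult gauss_approx_uniform_limit)
    have "(\<lambda>n. complex_of_real (C n)) \<longlonglongrightarrow> of_real (1 / sqrt pi)"
      unfolding C_def by (intro tendsto_of_real stirling_mode)
    thus "uniform_limit (cball 0 R) (\<lambda>n (v::complex). complex_of_real (C n)) (\<lambda>v. of_real (1 / sqrt pi)) sequentially"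
      by (simp add: uniform_limit_iff tendsto_iff)
    show "bounded ((\<lambda>v::complex. exp (- (v ^ 2))) ` cball 0 R)"
      by (intro compact_imp_bounded compact_continuous_image continuous_intros) auto
    show "bounded ((\<lambda>v::complex. complex_of_real (1 / sqrt pi)) ` cball 0 R)"
      by (rule finite_imp_bounded) (auto intro: finite_subset[of _ "{complex_of_real (1 / sqrt pi)}"])
  qed
  from uniform_limitD[OF this d(1)]
  have ev1: "\<forall>\<^sub>F n in sequentially. \<forall>v\<in>cball (0::complex) R. dist (of_real (C n) * gauss_approx n v) (of_real (1 / sqrt pi) * exp (- (v ^ 2))) < d" .
  have ev2: "\<forall>\<^sub>F n in sequentially. dist (expsec n (real n)) (1 / 2) < e / 2"
    by (rule tendstoD[OF expsec_real_middle]) (use \<open>e > 0\<close> in simp)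
  show "\<forall>\<^sub>F n in sequentially. \<forall>v\<in>cball 0 R. dist (expsec n (of_nat n + of_real (sqrt (2 * real n)) * v)) (cerfc v / 2) < e"
    using ev1 ev2 eventually_gt_at_top[of 0]
  proof (eventually_elim, intro ballI)
    fix n and v :: complex assume 1: "\<forall>v\<in>cball (0::complex) R. dist (of_real (C n) * gauss_approx n v) (of_real (1 / sqrt pi) * exp (- (v ^ 2))) < d"
      and 2: "dist (expsec n (real n)) (1 / 2) < e / 2" and n: "n > (0::nat)" and v: "v \<in> cball 0 R"
    define F where "F v = expsec n (of_nat n + of_real (sqrt (2 * real n)) * v)" for v :: complex
    have D: "(F has_field_derivative (- (of_real (C n) * gauss_approx n v))) (at v within UNIV)" for v
      using expsec_affine_deriv[OF n, of v] unfolding F_def C_def by simp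
    have I1: "((\<lambda>v. - (of_real (C n) * gauss_approx n v)) has_contour_integral (F v - F 0)) (linepath 0 v)"
      using contour_integral_primitive[OF D, of "linepath 0 v"] by simp
    have "(\<lambda>t. exp (- (t ^ 2))) contour_integrable_on linepath 0 v"
      by (intro contour_integrable_continuous_linepath continuous_intros)
    hence I2: "((\<lambda>t. of_real (1 / sqrt pi) * exp (- (t ^ 2))) has_contour_integral
        (of_real (1 / sqrt pi) * contour_integral (linepath 0 v) (\<lambda>t. exp (- (t ^ 2))))) (linepath 0 v)"
      by (intro has_contour_integral_lmul has_contour_integral_integral)
    have "norm ((F v - F 0) + (of_real (1 / sqrt pi) * contour_integral (linepath 0 v) (\<lambda>t. exp (- (t ^ 2))))) \<le> d * norm (v - 0)"
    proof (rule has_contour_integral_bound_linepath[OF has_contour_integral_add[OF I1 I2]])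
      fix x assume "x \<in> closed_segment 0 v"
      hence "norm x \<le> norm v" using segment_bound1[of x 0 v] by simp
      hence "x \<in> cball 0 R" using v by simp
      with 1 show "norm (- (of_real (C n) * gauss_approx n x) + of_real (1 / sqrt pi) * exp (- (x ^ 2))) \<le> d"
        by (force simp: dist_norm norm_minus_commute)
    qed (use d in auto)
    also have "d * norm (v - 0) \<le> d * \<bar>R\<bar>" using v d by (intro mult_left_mono) auto
    also have "\<dots> < e / 2" by (rule d)
    also have "(F v - F 0) + (of_real (1 / sqrt pi) * contour_integral (linepath 0 v) (\<lambda>t. exp (- (t ^ 2)))) = F v - cerfc v / 2 - (F 0 - 1 / 2)"
      by (simp add: cerfc_def cerf_def field_simps)
    finally have "norm (F v - cerfc v / 2 - (F 0 - 1 / 2)) < e / 2" .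
    moreover have "norm (F 0 - 1 / 2) < e / 2"
    proof -
      have "F 0 - 1 / 2 = of_real (expsec n (real n) - 1 / 2)" using expsec_of_real[of n "real n"] by (simp add: F_def)
      thus ?thesis using 2 by (simp only: norm_of_real dist_real_def)
    qed
    ultimately have "norm (F v - cerfc v / 2) < e"
      using norm_triangle_ineq[of "F v - cerfc v / 2 - (F 0 - 1 / 2)" "F 0 - 1 / 2"] by simp
    thus "dist (expsec n (of_nat n + of_real (sqrt (2 * real n)) * v)) (cerfc v / 2) < e" by (simp add: dist_norm F_def)
  qed
qed

section \<open>Comparison with the Ginibre kernel\<close>

text \<open>Taylor sections at 0: their radius of convergence exceeds \<open>r\<close>, so they
  converge uniformly on the closed disc.\<close>

lemma holomorphic_uniform_polynomial:
  assumes f: "f holomorphic_on ball 0 R" and r: "0 \<le> r" "r < R" and e: "e > 0"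
  obtains p :: "complex poly" where "\<And>z. cmod z \<le> r \<Longrightarrow> cmod (poly p z - f z) < e"
proof -
  define a where "a n = (deriv ^^ n) f 0 / fact n" for n
  have sums: "(\<lambda>n. a n * (z - 0) ^ n) sums f z" if "cmod z < R" for z
    unfolding a_def using that by (intro holomorphic_power_series[OF f]) auto
  define s where "s = (r + R) / 2"
  have s: "r < s" "s < R" "0 < s" using r by (auto simp: s_def)
  have "summable (\<lambda>n. a n * (of_real s) ^ n)"
    using sums_summable[OF sums[of "of_real s"]] s by simp
  hence "conv_radius a \<ge> norm (complex_of_real s)" by (rule conv_radius_geI)
  hence "ereal r < conv_radius a" using s less_le_trans[of "ereal r" "ereal s" "conv_radius a"] by simp
  from uniform_limitD[OF powser_uniform_limit[OF this, of 0] e]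
  have "\<forall>\<^sub>F n in sequentially. \<forall>x\<in>cball 0 r. dist (\<Sum>i<n. a i * (x - 0) ^ i) (\<Sum>i. a i * (x - 0) ^ i) < e" .
  then obtain n where n: "\<forall>x\<in>cball 0 r. dist (\<Sum>i<n. a i * (x - 0) ^ i) (\<Sum>i. a i * (x - 0) ^ i) < e"
    using eventually_happens'[OF sequentially_bot] by blast
  show thesis
  proof
    fix z assume z: "cmod z \<le> r"
    have "(\<Sum>i. a i * (z - 0) ^ i) = f z" using sums[of z] z r by (simp add: sums_iff)
    moreover have "poly (\<Sum>i<n. monom (a i) i) z = (\<Sum>i<n. a i * (z - 0) ^ i)"
      by (simp add: poly_sum poly_monom)
    moreover have "dist (\<Sum>i<n. a i * (z - 0) ^ i) (\<Sum>i. a i * (z - 0) ^ i) < e"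
      using z by (intro bspec[OF n]) simp
    ultimately show "cmod (poly (\<Sum>i<n. monom (a i) i) z - f z) < e"
      by (simp only: dist_norm)
  qed
qed

section \<open>Gaussian inequalities and absorption of the exterior\<close>

lemma borel_measurable_poly [measurable]: "poly (f :: complex poly) \<in> borel_measurable borel"
  by (intro borel_measurable_continuous_onI continuous_intros)

lemma fock_norm_eq_0_imp:
  assumes "s > 0" "fock_norm s f = 0"
  shows "poly f z = 0"
  using fock_eval[OF assms(1), of f z] assms(2) by simp

text \<open>The bound comes from the weighted arithmetic-geometric mean inequality with a parameter
  \<open>t\<close>, optimal at \<open>t = fock_norm s g / fock_norm s f\<close>; if one of the norms
  is 0, that polynomial vanishes.\<close>

lemma gauss_Cauchy_Schwarz:
  assumes s: "s > 0"
  shows "integrable lborel (\<lambda>z. cmod (poly f z) * cmod (poly g z) * (exp (- s * (cmod z)^2) / pi))" (is "integrable _ ?h")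
    and "(LINT z|lborel. cmod (poly f z) * cmod (poly g z) * (exp (- s * (cmod z)^2) / pi)) \<le> fock_norm s f * fock_norm s g"
proof -
  let ?e = "\<lambda>z. exp (- s * (cmod z)^2) / pi"
  have F: "integrable lborel (\<lambda>z. (cmod (poly f z))^2 * ?e z)" "(LINT z|lborel. (cmod (poly f z))^2 * ?e z) = (fock_norm s f)^2" for f
    using fock_norm_integral[OF s, of f] by (auto simp: has_bochner_integral_iff)
  have bnd: "?h z \<le> (t * ((cmod (poly f z))^2 * ?e z) + (1 / t) * ((cmod (poly g z))^2 * ?e z)) / 2" if t: "t > 0" for t z
  proof -
    have "2 * (sqrt t * cmod (poly f z)) * (cmod (poly g z) / sqrt t) \<le> (sqrt t * cmod (poly f z))^2 + (cmod (poly g z) / sqrt t)^2"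
      by (rule sum_squares_bound)
    hence "2 * (cmod (poly f z) * cmod (poly g z)) \<le> t * (cmod (poly f z))^2 + (1 / t) * (cmod (poly g z))^2"
      using t by (simp add: power_mult_distrib power_divide)
    hence "(2 * (cmod (poly f z) * cmod (poly g z))) * ?e z \<le> (t * (cmod (poly f z))^2 + (1 / t) * (cmod (poly g z))^2) * ?e z"
      by (rule mult_right_mono) simp
    thus ?thesis by (simp add: algebra_simps)
  qed
  have int: "integrable lborel (\<lambda>z. (t * ((cmod (poly f z))^2 * ?e z) + (1 / t) * ((cmod (poly g z))^2 * ?e z)) / 2)" for t
    using F(1)[of f] F(1)[of g] by (intro integrable_divide Bochner_Integration.integrable_add integrable_mult_right)
  have meas: "?h \<in> borel_measurable lborel" by simp
  show ih: "integrable lborel ?h"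
    by (rule Bochner_Integration.integrable_bound[OF int[of 1] meas])
       (intro AE_I2, use bnd[of 1] in \<open>simp add: abs_mult\<close>)
  have *: "(LINT z|lborel. ?h z) \<le> (t * (fock_norm s f)^2 + (1 / t) * (fock_norm s g)^2) / 2" if "t > 0" for t
  proof -
    have "(LINT z|lborel. ?h z) \<le> (LINT z|lborel. (t * ((cmod (poly f z))^2 * ?e z) + (1 / t) * ((cmod (poly g z))^2 * ?e z)) / 2)"
      by (rule integral_mono[OF ih int bnd[OF that]])
    also have "\<dots> = (t * (fock_norm s f)^2 + (1 / t) * (fock_norm s g)^2) / 2"
      using F(1)[of f] F(1)[of g]
      by (simp only: integral_divide_zero Bochner_Integration.integral_add integrable_mult_right integral_mult_right_zero F(2))
    finally show ?thesis .
  qed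
  show "(LINT z|lborel. ?h z) \<le> fock_norm s f * fock_norm s g"
  proof (cases "fock_norm s f = 0 \<or> fock_norm s g = 0")
    case True
    hence "(\<forall>z. poly f z = 0) \<or> (\<forall>z. poly g z = 0)" using fock_norm_eq_0_imp[OF s] by blast
    hence h0: "?h z = 0" for z by auto
    show ?thesis unfolding h0 using fock_norm_nonneg[OF s] by simp
  next
    case False
    hence pos: "fock_norm s f > 0" "fock_norm s g > 0" using fock_norm_nonneg[OF s] by (simp_all add: less_le)
    show ?thesis using *[of "fock_norm s g / fock_norm s f"] pos by (simp add: power2_eq_square)
  qed
qed

lemma gauss_prob: "has_bochner_integral lborel (\<lambda>z::complex. exp (- ((cmod z)^2)) / pi) 1"
  using has_bochner_integral_mult_left[OF has_bochner_integral_gauss_moment[of 1 0], of "1 / pi"] by simp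

lemma fock_tail_pair:
  assumes N: "real N * (1 - 1 / r\<^sup>2) \<ge> 1" and r: "r > 1" and deg: "degree f < N + m" "degree g < N + m" and z: "cmod z \<ge> r"
  shows "cmod (poly f z) * cmod (poly g z) * (exp (- real N * (cmod z)^2) / pi)
           \<le> fock_norm N f * fock_norm N g * tail_const r m N * (exp (- ((cmod z)^2)) / pi)"
proof -
  have N0: "real N > 0" using N by (cases "N = 0") auto
  let ?E = "exp (- real N * (cmod z)^2)" and ?e = "tail_const r m N * exp (- ((cmod z)^2))"
  have t: "tail_const r m N \<ge> 0" using r by (intro tail_const_nonneg) simp
  have "(cmod (poly f z) * cmod (poly g z) * ?E)^2 = ((cmod (poly f z))^2 * ?E) * ((cmod (poly g z))^2 * ?E)"
    by (simp add: power2_eq_square)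
  also have "\<dots> \<le> ((fock_norm N f)^2 * tail_const r m N * exp (- ((cmod z)^2))) * ((fock_norm N g)^2 * tail_const r m N * exp (- ((cmod z)^2)))"
    using t by (intro mult_mono fock_tail N r deg z) auto
  also have "\<dots> = (fock_norm N f * fock_norm N g * ?e)^2" by (simp add: power2_eq_square)
  finally have "cmod (poly f z) * cmod (poly g z) * ?E \<le> fock_norm N f * fock_norm N g * ?e"
    by (rule power2_le_imp_le) (use t in \<open>auto intro!: mult_nonneg_nonneg fock_norm_nonneg N0\<close>)
  from divide_right_mono[OF this, of pi] show ?thesis by (simp add: mult.assoc)
qed

text \<open>By \<open>fock_tail_pair\<close> the mass outside the disc is at most half of the full
  squared norm, so it can be moved to the left side. \<open>G\<close> is left open to serve both a
  multiplier bounded on the disc and the comparison with the perturbed weight.\<close>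

lemma fock_norm_absorb:
  assumes N: "real N * (1 - 1 / r\<^sup>2) \<ge> 1" and r: "r > 1" and deg: "degree f < N + m" and small: "tail_const r m N \<le> 1 / 2"
    and G: "integrable lborel G" "\<And>z. 0 \<le> G z"
    and le: "\<And>z. cmod z \<le> r \<Longrightarrow> (cmod (poly f z))^2 * (exp (- real N * (cmod z)^2) / pi) \<le> G z"
  shows "(fock_norm N f)^2 \<le> 2 * (LINT z|lborel. G z)"
proof -
  have N0: "real N > 0" using N by (cases "N = 0") auto
  let ?g = "\<lambda>z. (fock_norm N f)^2 * tail_const r m N * (exp (- ((cmod z)^2)) / pi)"
  have t: "tail_const r m N \<ge> 0" using r by (intro tail_const_nonneg) simp
  have gi: "integrable lborel (\<lambda>z::complex. exp (- ((cmod z)^2)) / pi)" "(LINT z::complex|lborel. exp (- ((cmod z)^2)) / pi) = 1"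
    using gauss_prob by (auto simp: has_bochner_integral_iff)
  have pt: "(cmod (poly f z))^2 * (exp (- real N * (cmod z)^2) / pi) \<le> G z + ?g z" for z
  proof (cases "cmod z \<le> r")
    case True
    thus ?thesis using le[of z] t by (simp add: add_increasing2)
  next
    case False
    hence "(cmod (poly f z))^2 * (exp (- real N * (cmod z)^2) / pi) \<le> ?g z"
      using fock_tail_pair[OF N r deg deg, of z] by (simp add: power2_eq_square)
    thus ?thesis using G(2)[of z] by linarith
  qed
  have "(fock_norm N f)^2 = (LINT z|lborel. (cmod (poly f z))^2 * (exp (- real N * (cmod z)^2) / pi))"
    using fock_norm_integral[OF N0, of f] by (simp add: has_bochner_integral_iff)
  also have "\<dots> \<le> (LINT z|lborel. G z + ?g z)"
    using fock_norm_integral[OF N0, of f] G gi pt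
    by (intro integral_mono Bochner_Integration.integrable_add integrable_mult_right) (auto simp: has_bochner_integral_iff)
  also have "\<dots> = (LINT z|lborel. G z) + (fock_norm N f)^2 * tail_const r m N"
    using G(1) gi by (subst Bochner_Integration.integral_add) (auto simp del: times_divide_eq_right)
  also have "(fock_norm N f)^2 * tail_const r m N \<le> (fock_norm N f)^2 * (1 / 2)"
    using small by (intro mult_left_mono) auto
  finally show ?thesis by simp
qed

text \<open>A nonconstant polynomial is unbounded as a multiplier, but only its values on the disc
  matter: the exterior is absorbed at the price of a factor \<open>sqrt 2\<close>.\<close>

lemma fock_norm_mult_le:
  assumes N: "real N * (1 - 1 / r\<^sup>2) \<ge> 1" and r: "r > 1" and deg: "degree (p * f) < N + m" and small: "tail_const r m N \<le> 1 / 2"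
    and p: "\<And>z. cmod z \<le> r \<Longrightarrow> cmod (poly p z) \<le> B"
  shows "fock_norm N (p * f) \<le> sqrt 2 * B * fock_norm N f"
proof -
  have N0: "real N > 0" using N by (cases "N = 0") auto
  have B0: "B \<ge> 0" using p[of 0] r by (simp add: order_trans[OF norm_ge_zero])
  have fi: "integrable lborel (\<lambda>z. (cmod (poly f z))^2 * (exp (- real N * (cmod z)^2) / pi))"
     "(LINT z|lborel. (cmod (poly f z))^2 * (exp (- real N * (cmod z)^2) / pi)) = (fock_norm N f)^2"
    using fock_norm_integral[OF N0, of f] by (auto simp: has_bochner_integral_iff)
  have "(fock_norm N (p * f))^2 \<le> 2 * (LINT z|lborel. B\<^sup>2 * ((cmod (poly f z))^2 * (exp (- real N * (cmod z)^2) / pi)))"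
  proof (rule fock_norm_absorb[OF N r deg small])
    show "integrable lborel (\<lambda>z. B\<^sup>2 * ((cmod (poly f z))^2 * (exp (- real N * (cmod z)^2) / pi)))"
      by (intro integrable_mult_right fi)
    fix z assume z: "cmod z \<le> r"
    have "(cmod (poly p z))^2 * ((cmod (poly f z))^2 * (exp (- real N * (cmod z)^2) / pi)) \<le> B\<^sup>2 * ((cmod (poly f z))^2 * (exp (- real N * (cmod z)^2) / pi))"
      using p[OF z] by (intro mult_right_mono power_mono) auto
    thus "(cmod (poly (p * f) z))^2 * (exp (- real N * (cmod z)^2) / pi) \<le> B\<^sup>2 * ((cmod (poly f z))^2 * (exp (- real N * (cmod z)^2) / pi))"
      by (simp add: norm_mult power_mult_distrib mult_ac)
  qed auto
  also have "\<dots> = 2 * (B\<^sup>2 * (fock_norm N f)^2)" by (simp only: integral_mult_right_zero fi(2))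
  also have "\<dots> = (sqrt 2 * B * fock_norm N f)^2" by (simp add: power_mult_distrib)
  finally show ?thesis by (rule power2_le_imp_le) (use B0 in \<open>auto intro!: mult_nonneg_nonneg fock_norm_nonneg N0\<close>)
qed

text \<open>A multiple of \<open>p n\<close> removes the top coefficient. The hypothesis is on
  coefficients instead of the degree so that the induction can start at \<open>n = 0\<close> with
  \<open>h = 0\<close>.\<close>

lemma orthonormal_expansion:
  assumes on: "orthonormal_polys W p" and h: "\<And>i. i \<ge> n \<Longrightarrow> coeff h i = 0"
  shows "\<exists>c. h = (\<Sum>j<n. smult (c j) (p j))"
  using h
proof (induction n arbitrary: h)
  case 0
  hence "h = 0" by (intro poly_eqI) simp
  thus ?case by simp
next
  case (Suc n)
  have dn: "degree (p n) = n" and ln: "coeff (p n) n \<noteq> 0"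
    using on unfolding orthonormal_polys_def by (metis, metis less_irrefl zero_complex.simps(1))
  define d where "d = coeff h n / coeff (p n) n"
  have "coeff (h - smult d (p n)) i = 0" if "i \<ge> n" for i
  proof (cases "i = n")
    case True thus ?thesis using ln by (simp add: d_def)
  next
    case False
    hence "i \<ge> Suc n" "i > degree (p n)" using that dn by auto
    thus ?thesis using Suc.prems by (simp add: coeff_eq_0)
  qed
  from Suc.IH[OF this] obtain c where c: "h - smult d (p n) = (\<Sum>j<n. smult (c j) (p j))" by blast
  have "h = (\<Sum>j<n. smult (c j) (p j)) + smult d (p n)" unfolding c[symmetric] by simp
  also have "\<dots> = (\<Sum>j<Suc n. smult ((c(n := d)) j) (p j))" by simp
  finally show ?case by blast
qed

lemma coeff_zero_of_degree_less: "degree h < n \<Longrightarrow> i \<ge> n \<Longrightarrow> coeff h i = 0"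
  by (rule coeff_eq_0) simp

lemma orthonormal_inner:
  assumes on: "orthonormal_polys W p"
  shows "has_bochner_integral lborel
     (\<lambda>z. poly (\<Sum>j<n. smult (c j) (p j)) z * cnj (poly (\<Sum>j<n. smult (d j) (p j)) z) * of_real (W z / pi))
     (\<Sum>j<n. c j * cnj (d j))"
proof -
  have hb: "has_bochner_integral lborel (\<lambda>z. poly (p i) z * cnj (poly (p j) z) * of_real (W z / pi)) (if i = j then 1 else 0)" for i j
    using on unfolding orthonormal_polys_def has_bochner_integral_iff by blast
  have eq: "poly (\<Sum>j<n. smult (c j) (p j)) z * cnj (poly (\<Sum>j<n. smult (d j) (p j)) z) * of_real (W z / pi)
     = (\<Sum>i<n. \<Sum>j<n. (c i * cnj (d j)) * (poly (p i) z * cnj (poly (p j) z) * of_real (W z / pi)))" for z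
    unfolding poly_sum cnj_sum sum_product
    by (simp add: sum_distrib_right sum_distrib_left sum_divide_distrib mult_ac)
  have "has_bochner_integral lborel
     (\<lambda>z. poly (\<Sum>j<n. smult (c j) (p j)) z * cnj (poly (\<Sum>j<n. smult (d j) (p j)) z) * of_real (W z / pi))
     (\<Sum>i<n. \<Sum>j<n. (c i * cnj (d j)) * (if i = j then 1 else 0))"
    unfolding eq by (intro has_bochner_integral_sum has_bochner_integral_mult_right hb)
  also have "(\<Sum>i<n. \<Sum>j<n. (c i * cnj (d j)) * (if i = j then 1 else 0)) = (\<Sum>j<n. c j * cnj (d j))"
    by (intro sum.cong refl) (simp add: if_distrib[of "\<lambda>x. _ * x"] sum.delta cong: if_cong)
  finally show ?thesis .
qed

lemma orthonormal_integrable: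
  assumes on: "orthonormal_polys W p" and "degree f < n" "degree g < n"
  shows "integrable lborel (\<lambda>z. poly f z * cnj (poly g z) * of_real (W z / pi))"
proof -
  obtain c where c: "f = (\<Sum>j<n. smult (c j) (p j))"
    using orthonormal_expansion[OF on coeff_zero_of_degree_less[OF assms(2)]] by blast
  obtain d where d: "g = (\<Sum>j<n. smult (d j) (p j))"
    using orthonormal_expansion[OF on coeff_zero_of_degree_less[OF assms(3)]] by blast
  show ?thesis unfolding c d using orthonormal_inner[OF on, where n = n and c = c and d = d] by (simp only: has_bochner_integral_iff)
qed

text \<open>The kernel without its weight, kept as a polynomial in the first variable so that its
  difference from the candidate can be a test polynomial.\<close>

definition reproducing_poly :: "(nat \<Rightarrow> complex poly) \<Rightarrow> nat \<Rightarrow> complex \<Rightarrow> complex poly" where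
  "reproducing_poly p n w = (\<Sum>j<n. smult (cnj (poly (p j) w)) (p j))"

lemma poly_reproducing_poly:
  "poly (reproducing_poly p n w) z = (\<Sum>j<n. poly (p j) z * cnj (poly (p j) w))"
  by (simp add: reproducing_poly_def poly_sum mult.commute)

lemma degree_reproducing_poly:
  assumes "orthonormal_polys W p" "n > 0"
  shows "degree (reproducing_poly p n w) < n"
  unfolding reproducing_poly_def
  by (rule degree_sum_less) (use assms in \<open>auto simp: orthonormal_polys_def intro: le_less_trans[OF degree_smult_le]\<close>)

lemma reproducing_property:
  assumes on: "orthonormal_polys W p" and h: "degree h < n"
  shows "has_bochner_integral lborel (\<lambda>z. poly h z * cnj (poly (reproducing_poly p n w) z) * of_real (W z / pi)) (poly h w)"
proof -
  obtain c where c: "h = (\<Sum>j<n. smult (c j) (p j))"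
    using orthonormal_expansion[OF on coeff_zero_of_degree_less[OF h]] by blast
  have "has_bochner_integral lborel (\<lambda>z. poly h z * cnj (poly (reproducing_poly p n w) z) * of_real (W z / pi))
     (\<Sum>j<n. c j * cnj (cnj (poly (p j) w)))"
    unfolding c reproducing_poly_def by (rule orthonormal_inner[OF on])
  also have "(\<Sum>j<n. c j * cnj (cnj (poly (p j) w))) = poly h w" by (simp add: c poly_sum)
  finally show ?thesis .
qed

lemma poisson_block_le:
  assumes "x \<ge> 0" "n > 0"
  shows "(\<Sum>j\<in>{n..<M}. x ^ j / fact j) \<le> real (M - n) * poisson_mode n * exp x"
proof -
  have "(\<Sum>j\<in>{n..<M}. x ^ j / fact j) \<le> (\<Sum>j\<in>{n..<M}. poisson_mode n * exp x)"
  proof (rule sum_mono)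
    fix j assume j: "j \<in> {n..<M}"
    have "x ^ j / fact j \<le> poisson_mode j * exp x" using j assms by (intro poisson_le_mode) auto
    also have "\<dots> \<le> poisson_mode n * exp x" using j assms by (intro mult_right_mono poisson_mode_antimono) auto
    finally show "x ^ j / fact j \<le> poisson_mode n * exp x" .
  qed
  thus ?thesis by (simp add: mult.assoc)
qed

text \<open>Applied with \<open>n = N - m\<close>: changing the cutoff by a fixed number of degrees
  costs a vanishing fraction of the size of the kernel.\<close>

lemma ginibre_poly_diff_le:
  assumes "0 < n" "n \<le> N"
  shows "cmod (poly (ginibre_poly N (real N) w) z - poly (ginibre_poly n (real N) w) z)
           \<le> real (N - n) * poisson_mode n * (real N * exp (real N * ((cmod z)^2 + (cmod w)^2) / 2))"
proof -
  define x where "x = real N * cmod z * cmod w"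
  have x: "x \<ge> 0" by (simp add: x_def)
  have split: "(\<Sum>j<N. (of_real (real N) * z * cnj w) ^ j / fact j) =
      (\<Sum>j<n. (of_real (real N) * z * cnj w) ^ j / fact j) + (\<Sum>j\<in>{n..<N}. (of_real (real N) * z * cnj w) ^ j / fact j)"
    unfolding lessThan_atLeast0 by (rule sum.atLeastLessThan_concat[symmetric]) (use assms in auto)
  have "cmod (poly (ginibre_poly N (real N) w) z - poly (ginibre_poly n (real N) w) z)
      = real N * cmod (\<Sum>j\<in>{n..<N}. (of_real (real N) * z * cnj w) ^ j / fact j)"
    unfolding poly_ginibre_poly split by (simp add: distrib_left norm_mult)
  also have "\<dots> \<le> real N * (\<Sum>j\<in>{n..<N}. x ^ j / fact j)"
    by (intro mult_left_mono sum_norm_le) (auto simp: norm_divide norm_power norm_mult x_def)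
  also have "\<dots> \<le> real N * (real (N - n) * poisson_mode n * exp x)"
    using x assms by (intro mult_left_mono poisson_block_le) auto
  also have "\<dots> \<le> real N * (real (N - n) * poisson_mode n * exp (real N * ((cmod z)^2 + (cmod w)^2) / 2))"
  proof -
    have "2 * cmod z * cmod w \<le> (cmod z)^2 + (cmod w)^2" by (rule sum_squares_bound)
    hence "real N * (2 * cmod z * cmod w) \<le> real N * ((cmod z)^2 + (cmod w)^2)" by (rule mult_left_mono) simp
    hence "x \<le> real N * ((cmod z)^2 + (cmod w)^2) / 2" by (simp add: x_def)
    thus ?thesis using poisson_mode_pos[of n] assms by (intro mult_left_mono mult_nonneg_nonneg) auto
  qed
  finally show ?thesis by (simp add: mult_ac)
qed

text \<open>Outside the disc of radius \<open>r\<close> nothing ties \<open>V\<close> to \<phi>;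
  there only integrability against \<open>exp (- (cmod z)^2)\<close> is asked, the factor that
  \<open>fock_tail\<close> leaves over. Holomorphy up to the larger radius \<open>R\<close> makes
  Taylor sections of \<phi> and of \<open>1 / \<phi>\<close> converge uniformly on the closed
  disc.\<close>

locale analytic_weight =
  fixes V :: "complex \<Rightarrow> real" and \<phi> :: "complex \<Rightarrow> complex" and r R :: real
  assumes r: "1 < r" and rR: "r < R"
    and holo: "\<phi> holomorphic_on ball 0 R"
    and nonzero: "\<And>z. cmod z < R \<Longrightarrow> \<phi> z \<noteq> 0"
    and V_nonneg: "\<And>z. 0 \<le> V z"
    and V_int: "integrable lborel (\<lambda>z. V z * exp (- ((cmod z)^2)))"
    and V_eq: "\<And>z. cmod z \<le> r \<Longrightarrow> V z * (cmod (\<phi> z))^2 = 1"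
begin

definition mass :: real where
  "mass = (LINT z|lborel. V z * (exp (- ((cmod z)^2)) / pi))"

lemma mass_nonneg: "mass \<ge> 0"
  unfolding mass_def by (intro integral_nonneg_AE AE_I2 mult_nonneg_nonneg V_nonneg) auto

lemma V_int': "integrable lborel (\<lambda>z. V z * (exp (- ((cmod z)^2)) / pi))"
  using integrable_divide[OF V_int, of pi] by simp

lemma bounded_symbol:
  obtains B where "B \<ge> 1" "\<And>z. cmod z \<le> r \<Longrightarrow> cmod (\<phi> z) \<le> B" "\<And>z. cmod z \<le> r \<Longrightarrow> cmod (1 / \<phi> z) \<le> B"
proof -
  have c: "continuous_on (cball 0 r) \<phi>"
    by (rule continuous_on_subset[OF holomorphic_on_imp_continuous_on[OF holo]]) (use rR in auto)
  hence "continuous_on (cball 0 r) (\<lambda>z. 1 / \<phi> z)"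
    using nonzero rR by (intro continuous_intros) auto
  hence "bounded ((\<lambda>z. 1 / \<phi> z) ` cball 0 r)"
    by (intro compact_imp_bounded compact_continuous_image compact_cball)
  moreover from c have "bounded (\<phi> ` cball 0 r)"
    by (intro compact_imp_bounded compact_continuous_image compact_cball)
  ultimately obtain B1 B2 where "\<forall>x\<in>\<phi> ` cball 0 r. norm x \<le> B1" "\<forall>x\<in>(\<lambda>z. 1 / \<phi> z) ` cball 0 r. norm x \<le> B2"
    unfolding bounded_iff by blast
  hence B12: "\<And>z. cmod z \<le> r \<Longrightarrow> cmod (\<phi> z) \<le> B1" "\<And>z. cmod z \<le> r \<Longrightarrow> cmod (1 / \<phi> z) \<le> B2" by auto
  show thesis
    by (rule that[of "max 1 (max B1 B2)"]) (use B12 in \<open>force simp: le_max_iff_disj\<close>)+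
qed

end

text \<open>One \<open>N\<close> is fixed together with polynomial substitutes: \<open>T\<close> for
  \<phi>, used in the candidate kernel, and \<open>T'\<close> for \<open>1 / \<phi>\<close>, used on
  the test polynomial. The conditions \<open>large\<close>, \<open>small\<close> and
  \<open>mN\<close> hold eventually once \<open>m\<close> is fixed.\<close>

locale approximated_weight = analytic_weight +
  fixes N m :: nat and p :: "nat \<Rightarrow> complex poly" and B \<epsilon> :: real and T T' :: "complex poly"
  assumes on: "orthonormal_polys (\<lambda>z. V z * exp (- real N * (cmod z)^2)) p"
    and large: "real N * (1 - 1 / r\<^sup>2) \<ge> 1" and small: "tail_const r m N \<le> 1 / 2" and mN: "m < N"
    and B1: "B \<ge> 1" and phi_le: "\<And>z. cmod z \<le> r \<Longrightarrow> cmod (\<phi> z) \<le> B" and psi_le: "\<And>z. cmod z \<le> r \<Longrightarrow> cmod (1 / \<phi> z) \<le> B"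
    and degT: "degree T \<le> m" and degT': "degree T' \<le> m" and eps: "0 \<le> \<epsilon>" "\<epsilon> \<le> 1"
    and T: "\<And>z. cmod z \<le> r \<Longrightarrow> cmod (poly T z - \<phi> z) \<le> \<epsilon>"
    and T': "\<And>z. cmod z \<le> r \<Longrightarrow> cmod (poly T' z - 1 / \<phi> z) \<le> \<epsilon>"
begin

abbreviation gw :: "complex \<Rightarrow> real" where "gw z \<equiv> exp (- real N * (cmod z)^2) / pi"
abbreviation gw1 :: "complex \<Rightarrow> real" where "gw1 z \<equiv> exp (- ((cmod z)^2)) / pi"
abbreviation ksec :: "complex \<Rightarrow> complex poly" where "ksec w \<equiv> ginibre_poly (N - m) (real N) w"
abbreviation amp :: "complex \<Rightarrow> real" where "amp w \<equiv> sqrt (real N) * exp (real N * (cmod w)^2 / 2)"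

lemma N_pos: "real N > 0" using mN by simp

lemma T_le: "cmod z \<le> r \<Longrightarrow> cmod (poly T z) \<le> 2 * B"
  using norm_triangle_sub[of "poly T z" "\<phi> z"] T[of z] phi_le[of z] eps B1 by linarith

lemma T'_le: "cmod z \<le> r \<Longrightarrow> cmod (poly T' z) \<le> 2 * B"
  using norm_triangle_sub[of "poly T' z" "1 / \<phi> z"] T'[of z] psi_le[of z] eps B1 by linarith

lemma fock_norm_mult_B:
  assumes "degree (q * f) < N + m" "\<And>z. cmod z \<le> r \<Longrightarrow> cmod (poly q z) \<le> 2 * B"
  shows "fock_norm N (q * f) \<le> 3 * B * fock_norm N f"
proof -
  have "fock_norm N (q * f) \<le> sqrt 2 * (2 * B) * fock_norm N f"
    by (rule fock_norm_mult_le[OF large r assms(1) small assms(2)])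
  also have "sqrt 2 * (2 * B) \<le> 3 * B"
    using B1 real_le_lsqrt[of "3 / 2" 2] by (simp add: power2_eq_square)
  hence "sqrt 2 * (2 * B) * fock_norm N f \<le> 3 * B * fock_norm N f"
    by (intro mult_right_mono fock_norm_nonneg N_pos)
  finally show ?thesis .
qed

text \<open>The terms are, in order: replacing \<open>V * cnj T\<close> by \<open>T'\<close> on the
  disc, the exterior of the disc, the degrees from \<open>N - m\<close> on lost in the truncation,
  and replacing \<open>T'\<close> by \<open>1 / \<phi>\<close> at \<open>w\<close>.\<close>

definition pairing_error :: real where
  "pairing_error = 2 * B\<^sup>2 * \<epsilon> + 3 * B * tail_const r m N * (mass + 1) + 3 * B * sqrt (2 * m * poisson_mode (N - m)) + \<epsilon>"

lemma pairing_error_nonneg: "pairing_error \<ge> 0"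
proof -
  have "tail_const r m N \<ge> 0" using r by (intro tail_const_nonneg) simp
  thus ?thesis using B1 eps mass_nonneg poisson_mode_pos[of "N - m"] mN
    unfolding pairing_error_def by (intro add_nonneg_nonneg mult_nonneg_nonneg) auto
qed

lemma degree_ksec: "degree (ksec w) < N - m"
  using mN by (intro degree_ginibre_poly) simp

text \<open>The reason for cutting the Gaussian kernel at \<open>N - m\<close>: after multiplication
  by \<open>T\<close> it still lies in the span of the first \<open>N\<close> orthonormal
  polynomials.\<close>

lemma degree_T_ksec: "degree (T * ksec w) < N"
  using degree_mult_le[of T "ksec w"] degT degree_ksec[of w] by linarith

text \<open>The multiplier moves from the kernel section to the test polynomial: on the disc
  \<open>V * cnj \<phi> = 1 / \<phi>\<close>, so \<open>V * cnj T\<close> is close to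
  \<open>T'\<close>. Outside no cancellation is available; both products are bounded separately,
  which leaves \<open>V\<close> as an integrable factor.\<close>

lemma pairing_pointwise:
  assumes h: "degree h < N"
  shows "cmod (poly h z * cnj (poly (T * ksec w) z) * of_real (V z * gw z) - poly (T' * h) z * cnj (poly (ksec w) z) * of_real (gw z))
    \<le> 2 * B\<^sup>2 * \<epsilon> * (cmod (poly h z) * cmod (poly (ksec w) z) * gw z)
       + 3 * B * tail_const r m N * fock_norm N h * fock_norm N (ksec w) * (V z * gw1 z + gw1 z)" (is "?L \<le> ?X + ?Y")
proof (cases "cmod z \<le> r")
  case True
  have nz: "\<phi> z \<noteq> 0" using True rR by (intro nonzero) simp
  have Vz: "of_real (V z) * (\<phi> z * cnj (\<phi> z)) = 1"
    using V_eq[OF True] unfolding complex_norm_square[symmetric] of_real_mult[symmetric] by simp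
  have V1: "V z = (cmod (1 / \<phi> z))^2" using V_eq[OF True] nz by (simp add: norm_divide field_simps)
  have VB: "V z \<le> B\<^sup>2" unfolding V1 using psi_le[OF True] by (intro power_mono) auto
  have psi: "cnj (\<phi> z) * of_real (V z) = 1 / \<phi> z" using Vz nz by (simp add: field_simps)
  have "cnj (poly T z) * of_real (V z) - poly T' z = cnj (poly T z - \<phi> z) * of_real (V z) - (poly T' z - 1 / \<phi> z)"
    by (simp add: algebra_simps psi)
  also have "cmod \<dots> \<le> cmod (cnj (poly T z - \<phi> z) * of_real (V z)) + cmod (poly T' z - 1 / \<phi> z)"
    by (rule norm_triangle_ineq4)
  also have "cmod (cnj (poly T z - \<phi> z) * of_real (V z)) = cmod (poly T z - \<phi> z) * V z"
    by (simp only: norm_mult complex_mod_cnj norm_of_real abs_of_nonneg[OF V_nonneg])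
  also have "\<dots> + cmod (poly T' z - 1 / \<phi> z) \<le> \<epsilon> * B\<^sup>2 + \<epsilon> * 1"
    using T[OF True] T'[OF True] VB V_nonneg eps by (intro add_mono mult_mono) auto
  also have "\<dots> \<le> \<epsilon> * B\<^sup>2 + \<epsilon> * B\<^sup>2"
    using eps B1 by (intro add_left_mono mult_left_mono) (auto simp: one_le_power)
  finally have br: "cmod (cnj (poly T z) * of_real (V z) - poly T' z) \<le> 2 * B\<^sup>2 * \<epsilon>" by (simp add: mult_ac)
  have "?L = cmod (poly h z) * cmod (poly (ksec w) z) * gw z * cmod (cnj (poly T z) * of_real (V z) - poly T' z)"
  proof -
    have "poly h z * cnj (poly (T * ksec w) z) * of_real (V z * gw z) - poly (T' * h) z * cnj (poly (ksec w) z) * of_real (gw z)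
        = poly h z * cnj (poly (ksec w) z) * of_real (gw z) * (cnj (poly T z) * of_real (V z) - poly T' z)"
      by (simp only: poly_mult complex_cnj_mult of_real_mult algebra_simps)
    also have "cmod \<dots> = cmod (poly h z) * cmod (poly (ksec w) z) * gw z * cmod (cnj (poly T z) * of_real (V z) - poly T' z)"
      by (simp only: norm_mult complex_mod_cnj norm_of_real) simp
    finally show ?thesis .
  qed
  also have "\<dots> \<le> cmod (poly h z) * cmod (poly (ksec w) z) * gw z * (2 * B\<^sup>2 * \<epsilon>)"
    using br by (intro mult_left_mono mult_nonneg_nonneg) auto
  also have "\<dots> \<le> ?X + ?Y"
  proof -
    have "tail_const r m N \<ge> 0" using r by (intro tail_const_nonneg) simp
    hence "?Y \<ge> 0" using B1 V_nonneg N_pos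
      by (intro mult_nonneg_nonneg fock_norm_nonneg add_nonneg_nonneg) auto
    thus ?thesis by (simp add: mult_ac)
  qed
  finally show ?thesis .
next
  case False
  hence z: "cmod z \<ge> r" by simp
  have t: "tail_const r m N \<ge> 0" using r by (intro tail_const_nonneg) simp
  have dT'h: "degree (T' * h) < N + m" using degree_mult_le[of T' h] degT' h by linarith
  have "?L \<le> cmod (poly h z * cnj (poly (T * ksec w) z) * of_real (V z * gw z)) + cmod (poly (T' * h) z * cnj (poly (ksec w) z) * of_real (gw z))"
    by (rule norm_triangle_ineq4)
  also have "\<dots> = V z * (cmod (poly h z) * cmod (poly (T * ksec w) z) * gw z) + cmod (poly (T' * h) z) * cmod (poly (ksec w) z) * gw z"
    by (simp only: norm_mult complex_mod_cnj norm_of_real) (simp add: V_nonneg)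
  also have "\<dots> \<le> V z * (fock_norm N h * fock_norm N (T * ksec w) * tail_const r m N * gw1 z)
       + fock_norm N (T' * h) * fock_norm N (ksec w) * tail_const r m N * gw1 z"
    using h degree_T_ksec[of w] degree_ksec[of w] dT'h
    by (intro add_mono mult_left_mono fock_tail_pair large r z V_nonneg) auto
  also have "\<dots> \<le> V z * (fock_norm N h * (3 * B * fock_norm N (ksec w)) * tail_const r m N * gw1 z)
       + (3 * B * fock_norm N h) * fock_norm N (ksec w) * tail_const r m N * gw1 z"
    using t dT'h degree_T_ksec[of w]
    by (intro add_mono mult_left_mono mult_right_mono fock_norm_mult_B T_le T'_le V_nonneg mult_nonneg_nonneg fock_norm_nonneg N_pos) auto
  also have "\<dots> = ?Y" by (simp add: algebra_simps)
  also have "\<dots> \<le> ?X + ?Y" using eps by simp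
  finally show ?thesis .
qed

text \<open>By \<open>pairing_pointwise\<close> the pairing is nearly the Gaussian pairing of
  \<open>T' * h\<close> with \<open>ksec w\<close>, which returns \<open>T' * h\<close> at
  \<open>w\<close> up to truncation, and \<open>T'\<close> is close to \<open>1 / \<phi>\<close>
  there.\<close>

lemma pairing_integral:
  assumes h: "degree h < N" and w: "cmod w \<le> r"
  shows "cmod ((LINT z|lborel. poly h z * cnj (poly (T * ksec w) z) * of_real (V z * gw z)) - poly h w / \<phi> w)
     \<le> fock_norm N h * amp w * pairing_error"
proof -
  let ?f = "\<lambda>z. poly h z * cnj (poly (T * ksec w) z) * of_real (V z * gw z)"
  let ?g = "\<lambda>z. poly (T' * h) z * cnj (poly (ksec w) z) * of_real (gw z)"
  let ?X = "\<lambda>z. cmod (poly h z) * cmod (poly (ksec w) z) * gw z"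
  let ?k = "fock_norm N (ksec w)" and ?h = "fock_norm N h" and ?t = "tail_const r m N"
  have t: "?t \<ge> 0" using r by (intro tail_const_nonneg) simp
  have h0: "?h \<ge> 0" by (intro fock_norm_nonneg N_pos)
  have kamp: "?k \<le> amp w" by (intro fock_norm_ginibre_poly N_pos)
  have dT'h: "degree (T' * h) < N + m" using degree_mult_le[of T' h] degT' h by linarith
  have fi: "integrable lborel ?f"
    using orthonormal_integrable[OF on h degree_T_ksec[of w]] by simp
  have g: "has_bochner_integral lborel ?g (\<Sum>j<N - m. coeff (T' * h) j * w ^ j)"
    using mN by (intro ginibre_reproducing N_pos) simp
  have gi: "integrable lborel ?g" using g by (simp add: has_bochner_integral_iff)
  have gw1: "integrable lborel gw1" "(LINT z|lborel. gw1 z) = 1"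
    using gauss_prob by (auto simp: has_bochner_integral_iff)
  have Y: "integrable lborel (\<lambda>z. V z * gw1 z + gw1 z)" "(LINT z|lborel. V z * gw1 z + gw1 z) = mass + 1"
    using V_int' gw1 by (auto simp: mass_def)
  have X: "integrable lborel ?X" "(LINT z|lborel. ?X z) \<le> ?h * ?k"
    by (intro gauss_Cauchy_Schwarz N_pos)+
  have "cmod ((LINT z|lborel. ?f z) - (LINT z|lborel. ?g z)) = cmod (LINT z|lborel. ?f z - ?g z)"
    using fi gi by simp
  also have "\<dots> \<le> (LINT z|lborel. cmod (?f z - ?g z))"
    by (rule integral_norm_bound)
  also have "\<dots> \<le> (LINT z|lborel. 2 * B\<^sup>2 * \<epsilon> * ?X z + 3 * B * ?t * ?h * ?k * (V z * gw1 z + gw1 z))"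
    using pairing_pointwise[OF h] fi gi X(1) V_int' gw1(1)
    by (intro integral_mono integrable_norm Bochner_Integration.integrable_diff Bochner_Integration.integrable_add integrable_mult_right)
  also have "\<dots> = 2 * B\<^sup>2 * \<epsilon> * (LINT z|lborel. ?X z) + 3 * B * ?t * ?h * ?k * (mass + 1)"
    using X(1) Y(1)
    by (simp only: Bochner_Integration.integral_add integrable_mult_right integral_mult_right_zero Y(2))
  also have "\<dots> \<le> 2 * B\<^sup>2 * \<epsilon> * (?h * ?k) + 3 * B * ?t * ?h * ?k * (mass + 1)"
    using X(2) eps by (intro add_right_mono mult_left_mono) auto
  also have "\<dots> = ?h * ?k * (2 * B\<^sup>2 * \<epsilon> + 3 * B * ?t * (mass + 1))" by (simp add: algebra_simps)
  also have "\<dots> \<le> ?h * amp w * (2 * B\<^sup>2 * \<epsilon> + 3 * B * ?t * (mass + 1))"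
    using kamp h0 t B1 eps mass_nonneg by (intro mult_right_mono mult_left_mono add_nonneg_nonneg mult_nonneg_nonneg) auto
  finally have 1: "cmod ((LINT z|lborel. ?f z) - (LINT z|lborel. ?g z)) \<le> ?h * amp w * (2 * B\<^sup>2 * \<epsilon> + 3 * B * ?t * (mass + 1))" .
  \<comment> \<open>The part of \<open>T' * h\<close> beyond the cutoff: \<open>2 * m\<close>
    degrees, each controlled by a Poisson mode.\<close>
  define tail where "tail = (\<Sum>j\<in>{N - m..<N + m}. coeff (T' * h) j * w ^ j)"
  have "poly (T' * h) w = (\<Sum>j<N + m. coeff (T' * h) j * w ^ j)" by (rule poly_eq_sum_lessThan[OF dT'h])
  also have "\<dots> = (\<Sum>j<N - m. coeff (T' * h) j * w ^ j) + tail"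
    unfolding tail_def lessThan_atLeast0 by (rule sum.atLeastLessThan_concat[symmetric]) auto
  finally have "poly (T' * h) w = (\<Sum>j<N - m. coeff (T' * h) j * w ^ j) + tail" .
  hence gint: "(LINT z|lborel. ?g z) = poly (T' * h) w - tail"
    using g by (simp add: has_bochner_integral_iff)
  have "cmod tail \<le> fock_norm N (T' * h) * sqrt (real N * (\<Sum>j\<in>{N - m..<N + m}. (real N * (cmod w)^2) ^ j / fact j))"
    unfolding tail_def by (intro fock_partial_eval N_pos) auto
  also have "\<dots> \<le> (3 * B * ?h) * sqrt (real N * (real (N + m - (N - m)) * poisson_mode (N - m) * exp (real N * (cmod w)^2)))"
    using mN B1 h0 by (intro mult_mono fock_norm_mult_B dT'h T'_le real_sqrt_le_mono mult_left_mono poisson_block_le)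
      (auto intro!: mult_nonneg_nonneg sum_nonneg)
  also have "real (N + m - (N - m)) = 2 * real m" using mN by simp
  also have "sqrt (real N * (2 * real m * poisson_mode (N - m) * exp (real N * (cmod w)^2)))
      = amp w * sqrt (2 * m * poisson_mode (N - m))"
  proof -
    have "sqrt (exp (real N * (cmod w)^2)) = exp (real N * (cmod w)^2 / 2)"
      by (rule real_sqrt_unique) (auto simp: exp_double[symmetric])
    thus ?thesis by (simp add: real_sqrt_mult mult_ac)
  qed
  finally have 2: "cmod tail \<le> ?h * amp w * (3 * B * sqrt (2 * m * poisson_mode (N - m)))" by (simp add: mult_ac)
  have "cmod (poly (T' * h) w - poly h w / \<phi> w) = cmod (poly T' w - 1 / \<phi> w) * cmod (poly h w)"
    by (simp add: norm_mult[symmetric] algebra_simps)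
  also have "\<dots> \<le> \<epsilon> * (?h * amp w)"
    using T'[OF w] fock_eval[OF N_pos, of h w] eps by (intro mult_mono) auto
  finally have 3: "cmod (poly (T' * h) w - poly h w / \<phi> w) \<le> ?h * amp w * \<epsilon>" by (simp add: mult_ac)
  have tri: "cmod (a - d) \<le> cmod (a - b) + cmod t + cmod (c - d)" if "b = c - t" for a b c d t :: complex
  proof -
    have "a - d = (a - b) - t + (c - d)" using that by simp
    thus ?thesis by (metis norm_triangle_ineq norm_triangle_ineq4 add_right_mono order_trans)
  qed
  have "cmod ((LINT z|lborel. ?f z) - poly h w / \<phi> w) \<le> cmod ((LINT z|lborel. ?f z) - (LINT z|lborel. ?g z)) + cmod tail + cmod (poly (T' * h) w - poly h w / \<phi> w)"
    by (rule tri[OF gint])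
  also have "\<dots> \<le> ?h * amp w * (2 * B\<^sup>2 * \<epsilon> + 3 * B * ?t * (mass + 1)) + ?h * amp w * (3 * B * sqrt (2 * m * poisson_mode (N - m))) + ?h * amp w * \<epsilon>"
    by (intro add_mono 1 2 3)
  also have "\<dots> = ?h * amp w * pairing_error" by (simp add: pairing_error_def algebra_simps)
  finally show ?thesis .
qed

text \<open>Pairing with \<open>T * ksec w\<close> nearly gives \<open>h w / \<phi> w\<close>. The
  second slot of the pairing is conjugate-linear, so the scalar \<open>cnj (\<phi> w)\<close> turns
  this into \<open>h w\<close>.\<close>

definition approx_kernel :: "complex \<Rightarrow> complex poly" where
  "approx_kernel w = smult (cnj (\<phi> w)) (T * ksec w)"

text \<open>The duality step. Testing both kernels on \<open>D\<close> bounds its squared perturbed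
  norm by \<open>B * ?D * amp w * pairing_error\<close>; \<open>?D^2\<close> is at most
  \<open>2 * B^2\<close> times that squared norm, and cancelling \<open>?D\<close> leaves the
  constant \<open>2 * B ^ 3\<close>.\<close>

lemma approx_kernel_error:
  assumes z: "cmod z \<le> r" and w: "cmod w \<le> r"
  shows "cmod (poly (reproducing_poly p N w) z - poly (approx_kernel w) z) \<le> 2 * B ^ 3 * pairing_error * (amp z * amp w)"
proof -
  define D where "D = reproducing_poly p N w - approx_kernel w"
  let ?D = "fock_norm N D"
  have nz: "\<phi> w \<noteq> 0" using w rR by (intro nonzero) simp
  have dq: "degree (approx_kernel w) < N"
    unfolding approx_kernel_def using degree_T_ksec[of w] degree_smult_le[of "cnj (\<phi> w)" "T * ksec w"] by linarith
  have dK: "degree (reproducing_poly p N w) < N" using mN by (intro degree_reproducing_poly[OF on]) simp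
  have dD: "degree D < N" unfolding D_def using dq dK by (rule degree_diff_less[rotated])
  have D0: "?D \<ge> 0" by (intro fock_norm_nonneg N_pos)
  have iDD: "integrable lborel (\<lambda>z. poly D z * cnj (poly D z) * of_real (V z * gw z))"
    using orthonormal_integrable[OF on dD dD] by simp
  have DD: "poly D z * cnj (poly D z) * of_real (V z * gw z) = of_real ((cmod (poly D z))^2 * (V z * gw z))" for z
    unfolding complex_norm_square[symmetric] of_real_mult[symmetric] ..
  have rDD: "integrable lborel (\<lambda>z. (cmod (poly D z))^2 * (V z * gw z))"
    using integrable_Re[OF iDD] unfolding DD Re_complex_of_real .
  have iq: "integrable lborel (\<lambda>z. poly D z * cnj (poly (T * ksec w) z) * of_real (V z * gw z))"
    using orthonormal_integrable[OF on dD degree_T_ksec[of w]] by simp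
  have K: "has_bochner_integral lborel (\<lambda>z. poly D z * cnj (poly (reproducing_poly p N w) z) * of_real (V z * gw z)) (poly D w)"
    using reproducing_property[OF on dD, of w] by simp
  have "of_real (LINT z|lborel. (cmod (poly D z))^2 * (V z * gw z)) = (LINT z|lborel. poly D z * cnj (poly D z) * of_real (V z * gw z))"
    unfolding DD by (rule integral_of_real[symmetric, OF rDD])
  also have "\<dots> = (LINT z|lborel. poly D z * cnj (poly (reproducing_poly p N w) z) * of_real (V z * gw z)
       - \<phi> w * (poly D z * cnj (poly (T * ksec w) z) * of_real (V z * gw z)))"
    by (intro Bochner_Integration.integral_cong refl)
       (subst (2) D_def, simp add: approx_kernel_def algebra_simps)
  also have "\<dots> = poly D w - \<phi> w * (LINT z|lborel. poly D z * cnj (poly (T * ksec w) z) * of_real (V z * gw z))"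
    using K iq by (subst Bochner_Integration.integral_diff) (simp_all add: has_bochner_integral_iff del: of_real_mult of_real_divide)
  also have "\<dots> = - \<phi> w * ((LINT z|lborel. poly D z * cnj (poly (T * ksec w) z) * of_real (V z * gw z)) - poly D w / \<phi> w)"
    using nz by (simp add: field_simps)
  finally have "cmod (of_real (LINT z|lborel. (cmod (poly D z))^2 * (V z * gw z))) =
      cmod (\<phi> w) * cmod ((LINT z|lborel. poly D z * cnj (poly (T * ksec w) z) * of_real (V z * gw z)) - poly D w / \<phi> w)"
    by (simp only: norm_mult norm_minus_cancel)
  also have "\<dots> \<le> B * (?D * amp w * pairing_error)"
    by (intro mult_mono phi_le pairing_integral w dD) (use B1 in auto)
  finally have int: "(LINT z|lborel. (cmod (poly D z))^2 * (V z * gw z)) \<le> B * (?D * amp w * pairing_error)"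
    by (simp only: norm_of_real)
  \<comment> \<open>On the disc \<open>1 <= B^2 * V\<close>, so the Gaussian density is dominated by
    the perturbed one there; the exterior is absorbed.\<close>
  have "?D^2 \<le> 2 * (LINT z|lborel. B\<^sup>2 * ((cmod (poly D z))^2 * (V z * gw z)))"
  proof (rule fock_norm_absorb[OF large r _ small])
    show "degree D < N + m" using dD by simp
    show "integrable lborel (\<lambda>z. B\<^sup>2 * ((cmod (poly D z))^2 * (V z * gw z)))" by (intro integrable_mult_right rDD)
    show "0 \<le> B\<^sup>2 * ((cmod (poly D z))^2 * (V z * gw z))" for z using V_nonneg by (intro mult_nonneg_nonneg) auto
    fix z assume z: "cmod z \<le> r"
    have "1 = (cmod (\<phi> z))^2 * V z" using V_eq[OF z] by (simp add: mult.commute)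
    also have "\<dots> \<le> B\<^sup>2 * V z" using phi_le[OF z] V_nonneg by (intro mult_right_mono power_mono) auto
    finally have "1 * ((cmod (poly D z))^2 * gw z) \<le> (B\<^sup>2 * V z) * ((cmod (poly D z))^2 * gw z)"
      by (rule mult_right_mono) simp
    thus "(cmod (poly D z))^2 * gw z \<le> B\<^sup>2 * ((cmod (poly D z))^2 * (V z * gw z))" by (simp add: mult_ac)
  qed
  also have "\<dots> = 2 * B\<^sup>2 * (LINT z|lborel. (cmod (poly D z))^2 * (V z * gw z))" by (simp only: integral_mult_right_zero mult.assoc)
  also have "\<dots> \<le> 2 * B\<^sup>2 * (B * (?D * amp w * pairing_error))" by (intro mult_left_mono int) auto
  finally have "?D * ?D \<le> ?D * (2 * B ^ 3 * amp w * pairing_error)"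
    by (simp add: power2_eq_square power3_eq_cube mult_ac)
  hence Dle: "?D \<le> 2 * B ^ 3 * amp w * pairing_error"
    using D0 pairing_error_nonneg B1 by (cases "?D = 0") (auto intro!: mult_nonneg_nonneg)
  have "cmod (poly D z) \<le> ?D * amp z" by (rule fock_eval[OF N_pos])
  also have "\<dots> \<le> (2 * B ^ 3 * amp w * pairing_error) * amp z" using Dle by (rule mult_right_mono) auto
  finally show ?thesis by (simp add: D_def mult_ac)
qed

lemma amp_mult: "amp z * amp w = real N * exp (real N * ((cmod z)^2 + (cmod w)^2) / 2)"
  by (simp add: exp_add[symmetric] field_simps)

lemma ginibre_poly_le: "cmod (poly (ginibre_poly n (real N) w) z) \<le> amp z * amp w"
proof -
  have "cmod (poly (ginibre_poly n (real N) w) z) \<le> fock_norm N (ginibre_poly n (real N) w) * amp z"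
    by (rule fock_eval[OF N_pos])
  also have "\<dots> \<le> amp w * amp z" by (intro mult_right_mono fock_norm_ginibre_poly N_pos) auto
  finally show ?thesis by (simp add: mult_ac)
qed

text \<open>Beyond \<open>approx_kernel_error\<close>, two changes in the candidate have to be
  undone: \<open>T\<close> goes back to \<phi>, and the cutoff \<open>N - m\<close> back to
  \<open>N\<close>, which costs \<open>m\<close> Poisson modes.\<close>

lemma kernel_comparison:
  assumes z: "cmod z \<le> r" and w: "cmod w \<le> r"
  shows "cmod (poly (reproducing_poly p N w) z - \<phi> z * cnj (\<phi> w) * poly (ginibre_poly N (real N) w) z)
     \<le> (2 * B ^ 3 * pairing_error + B * \<epsilon> + 2 * B\<^sup>2 * (m * poisson_mode (N - m))) * (real N * exp (real N * ((cmod z)^2 + (cmod w)^2) / 2))"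
proof -
  let ?K = "poly (ginibre_poly N (real N) w) z" and ?k = "poly (ksec w) z" and ?A = "amp z * amp w"
  have Kk: "cmod (?K - ?k) \<le> m * poisson_mode (N - m) * ?A"
    unfolding amp_mult using ginibre_poly_diff_le[of "N - m" N w z] mN by simp
  have "poly (approx_kernel w) z - \<phi> z * cnj (\<phi> w) * ?K = cnj (\<phi> w) * ((poly T z - \<phi> z) * ?K - poly T z * (?K - ?k))"
    by (simp add: approx_kernel_def algebra_simps)
  also have "cmod \<dots> \<le> B * (\<epsilon> * ?A + (2 * B) * (m * poisson_mode (N - m) * ?A))"
    unfolding norm_mult complex_mod_cnj
  proof (intro mult_mono phi_le w)
    have "cmod ((poly T z - \<phi> z) * ?K - poly T z * (?K - ?k)) \<le> cmod (poly T z - \<phi> z) * cmod ?K + cmod (poly T z) * cmod (?K - ?k)"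
      using norm_triangle_ineq4[of "(poly T z - \<phi> z) * ?K" "poly T z * (?K - ?k)"] by (simp only: norm_mult)
    also have "\<dots> \<le> \<epsilon> * ?A + (2 * B) * (m * poisson_mode (N - m) * ?A)"
      using eps B1 by (intro add_mono mult_mono T z T_le Kk ginibre_poly_le) auto
    finally show "cmod ((poly T z - \<phi> z) * ?K - poly T z * (?K - ?k)) \<le> \<epsilon> * ?A + (2 * B) * (m * poisson_mode (N - m) * ?A)" .
  qed (use B1 in auto)
  finally have 1: "cmod (poly (approx_kernel w) z - \<phi> z * cnj (\<phi> w) * ?K) \<le> B * (\<epsilon> * ?A + (2 * B) * (m * poisson_mode (N - m) * ?A))" .
  have "cmod (poly (reproducing_poly p N w) z - \<phi> z * cnj (\<phi> w) * ?K)
      \<le> 2 * B ^ 3 * pairing_error * ?A + B * (\<epsilon> * ?A + (2 * B) * (m * poisson_mode (N - m) * ?A))"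
    using norm_triangle_ineq[of "poly (reproducing_poly p N w) z - poly (approx_kernel w) z" "poly (approx_kernel w) z - \<phi> z * cnj (\<phi> w) * ?K"]
      approx_kernel_error[OF z w] 1 by simp
  also have "\<dots> = (2 * B ^ 3 * pairing_error + B * \<epsilon> + 2 * B\<^sup>2 * (m * poisson_mode (N - m))) * ?A"
    by (simp add: algebra_simps power2_eq_square)
  finally show ?thesis unfolding amp_mult .
qed

end

section \<open>Edge scaling\<close>

theorem (in analytic_weight) reproducing_kernel_limit:
  assumes on: "\<forall>N\<ge>1. orthonormal_polys (\<lambda>z. V z * exp (- real N * (cmod z)^2)) (P N)" and e: "e > 0"
  shows "\<forall>\<^sub>F N in sequentially. \<forall>z w. cmod z \<le> r \<longrightarrow> cmod w \<le> r \<longrightarrow>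
     cmod (poly (reproducing_poly (P N) N w) z - \<phi> z * cnj (\<phi> w) * poly (ginibre_poly N (real N) w) z)
       \<le> e * (real N * exp (real N * ((cmod z)^2 + (cmod w)^2) / 2))"
proof -
  obtain B where B: "B \<ge> 1" "\<And>z. cmod z \<le> r \<Longrightarrow> cmod (\<phi> z) \<le> B" "\<And>z. cmod z \<le> r \<Longrightarrow> cmod (1 / \<phi> z) \<le> B"
    using bounded_symbol by blast
  \<comment> \<open>\<open>C * \<epsilon>\<close> is what remains of the error bound when
    \<open>N\<close> grows with \<open>T\<close>, \<open>T'\<close> and \<open>m\<close> fixed:
    exterior and Poisson terms vanish, approximation terms do not. Hence \<epsilon> is chosen with
    \<open>C * \<epsilon> < e\<close> before \<open>N\<close>.\<close>
  define C where "C = 2 * B ^ 3 * (2 * B\<^sup>2 + 1) + B"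
  have C: "C > 0" unfolding C_def using B(1) by (intro add_nonneg_pos mult_nonneg_nonneg) auto
  define \<epsilon> where "\<epsilon> = min 1 (e / (2 * C))"
  have eps: "0 < \<epsilon>" "\<epsilon> \<le> 1" using e C by (auto simp: \<epsilon>_def)
  have "C * \<epsilon> \<le> C * (e / (2 * C))" using C by (intro mult_left_mono) (auto simp: \<epsilon>_def)
  also have "\<dots> < e" using C e by simp
  finally have Ce: "C * \<epsilon> < e" .
  have "0 \<le> r" using r by simp
  obtain T where T: "\<And>z. cmod z \<le> r \<Longrightarrow> cmod (poly T z - \<phi> z) < \<epsilon>"
    using holomorphic_uniform_polynomial[OF holo \<open>0 \<le> r\<close> rR eps(1)] by blast
  have "(\<lambda>z. 1 / \<phi> z) holomorphic_on ball 0 R"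
    using nonzero by (intro holomorphic_intros holo) auto
  then obtain T' where T': "\<And>z. cmod z \<le> r \<Longrightarrow> cmod (poly T' z - 1 / \<phi> z) < \<epsilon>"
    using holomorphic_uniform_polynomial[OF _ \<open>0 \<le> r\<close> rR eps(1)] by blast
  define m where "m = max (degree T) (degree T')"
  define pe where "pe N = 2 * B\<^sup>2 * \<epsilon> + 3 * B * tail_const r m N * (mass + 1) + 3 * B * sqrt (2 * m * poisson_mode (N - m)) + \<epsilon>" for N
  define E where "E N = 2 * B ^ 3 * pe N + B * \<epsilon> + 2 * B\<^sup>2 * (m * poisson_mode (N - m))" for N
  have mode: "(\<lambda>N. poisson_mode (N - m)) \<longlonglongrightarrow> 0"
    by (rule filterlim_compose[OF poisson_mode_tendsto_0 filterlim_minus_const_nat_at_top])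
  have tail: "tail_const r m \<longlonglongrightarrow> 0" by (rule tail_const_tendsto_0[OF r])
  have "E \<longlonglongrightarrow> 2 * B ^ 3 * (2 * B\<^sup>2 * \<epsilon> + 3 * B * 0 * (mass + 1) + 3 * B * sqrt (real (2 * m) * 0) + \<epsilon>) + B * \<epsilon> + 2 * B\<^sup>2 * (real m * 0)"
    unfolding E_def[abs_def] pe_def by (intro tendsto_intros mode tail)
  also have "2 * B ^ 3 * (2 * B\<^sup>2 * \<epsilon> + 3 * B * 0 * (mass + 1) + 3 * B * sqrt (real (2 * m) * 0) + \<epsilon>) + B * \<epsilon> + 2 * B\<^sup>2 * (real m * 0) = C * \<epsilon>"
    by (simp add: C_def algebra_simps)
  finally have evE: "\<forall>\<^sub>F N in sequentially. E N < e" using Ce by (rule order_tendstoD(2))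
  have ev_small: "\<forall>\<^sub>F N in sequentially. tail_const r m N < 1 / 2"
    by (rule order_tendstoD(2)[OF tail]) simp
  have r2: "1 - 1 / r\<^sup>2 > 0" using r by (simp add: one_less_power)
  have "\<forall>\<^sub>F N in sequentially. real N \<ge> 1 / (1 - 1 / r\<^sup>2)"
    using filterlim_real_sequentially by (simp add: filterlim_at_top)
  hence ev_large: "\<forall>\<^sub>F N in sequentially. real N * (1 - 1 / r\<^sup>2) \<ge> 1"
    by eventually_elim (use r2 in \<open>simp add: pos_divide_le_eq\<close>)
  show ?thesis
    using evE ev_small ev_large eventually_gt_at_top[of m]
  proof (eventually_elim, intro allI impI)
    fix N z w assume *: "E N < e" "tail_const r m N < 1 / 2" "real N * (1 - 1 / r\<^sup>2) \<ge> 1" "m < N"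
      and z: "cmod z \<le> r" and w: "cmod w \<le> r"
    interpret A: approximated_weight V \<phi> r R N m "P N" B \<epsilon> T T'
    proof
      show "orthonormal_polys (\<lambda>z. V z * exp (- real N * (cmod z)\<^sup>2)) (P N)" using * on by simp
    qed (use * B T T' eps in \<open>auto simp: m_def less_imp_le\<close>)
    have "A.pairing_error = pe N" by (simp add: A.pairing_error_def pe_def)
    hence "cmod (poly (reproducing_poly (P N) N w) z - \<phi> z * cnj (\<phi> w) * poly (ginibre_poly N (real N) w) z)
        \<le> E N * (real N * exp (real N * ((cmod z)^2 + (cmod w)^2) / 2))"
      using A.kernel_comparison[OF z w] by (simp only: E_def)
    also have "\<dots> \<le> e * (real N * exp (real N * ((cmod z)^2 + (cmod w)^2) / 2))"
      using * by (intro mult_right_mono) auto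
    finally show "cmod (poly (reproducing_poly (P N) N w) z - \<phi> z * cnj (\<phi> w) * poly (ginibre_poly N (real N) w) z)
        \<le> e * (real N * exp (real N * ((cmod z)^2 + (cmod w)^2) / 2))" .
  qed
qed

text \<open>Since \<open>|p| = 1\<close>,
  \<open>N * \<zeta> * cnj \<eta> = (sqrt N + z) * (sqrt N + cnj w)\<close> and \<open>p\<close>
  disappears. The exponential of this times the weights is
  \<open>Gfun z w * exp (\<i> * sqrt N * (Im z - Im w))\<close>; the two leading factors on the left
  remove that phase.\<close>

lemma ginibre_rescaled:
  fixes p z w :: complex and N :: nat
  assumes p: "cmod p = 1" and N: "N > 0"
  defines "s \<equiv> sqrt (real N)"
  defines "\<zeta> \<equiv> p + p * z / of_real s" and "\<eta> \<equiv> p + p * w / of_real s"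
  shows "exp (- (\<i> * of_real (s * Im z))) * cnj (exp (- (\<i> * of_real (s * Im w)))) *
       of_real (exp (- (real N * ((cmod \<zeta>)^2 + (cmod \<eta>)^2) / 2))) * poly (ginibre_poly N (real N) \<eta>) \<zeta> / of_nat N
     = Gfun z w * expsec (N - 1) (of_nat N + of_real s * (z + cnj w) + z * cnj w)"
proof -
  define X where "X z w = of_nat N + of_real s * (z + cnj w) + z * cnj w" for z w :: complex
  have s0: "s > 0" and ss: "of_real s * of_real s = (of_nat N :: complex)"
    using N by (auto simp: s_def simp flip: of_real_mult)
  have pp: "p * cnj p = 1" using p by (simp add: complex_norm_square[symmetric])
  have X: "of_nat N * (p + p * z / of_real s) * cnj (p + p * w / of_real s) = X z w" for z w
  proof -
    have "of_nat N * (p + p * z / of_real s) * cnj (p + p * w / of_real s)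
        = (p * cnj p) * ((of_real s * (1 + z / of_real s)) * (of_real s * (1 + cnj w / of_real s)))"
      unfolding ss[symmetric] by (simp add: algebra_simps)
    moreover have "of_real s * (1 + z / of_real s) = of_real s + z" for z :: complex
      using s0 by (simp add: field_simps)
    ultimately have "of_nat N * (p + p * z / of_real s) * cnj (p + p * w / of_real s) = (of_real s + z) * (of_real s + cnj w)"
      unfolding pp by simp
    thus ?thesis unfolding X_def ss[symmetric] by (simp add: algebra_simps)
  qed
  have XX: "of_real (real N * (cmod (p + p * z / of_real s))^2) = X z z" for z
    unfolding X[symmetric] of_real_mult complex_norm_square by simp
  obtain n where n: "N = Suc n" using N gr0_implies_Suc by blast
  have "poly (ginibre_poly N (real N) \<eta>) \<zeta> / of_nat N = (\<Sum>j<N. X z w ^ j / fact j)"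
    using N X[of z w] by (simp add: poly_ginibre_poly \<zeta>_def \<eta>_def)
  also have "\<dots> = exp (X z w) * expsec (N - 1) (X z w)"
    unfolding n lessThan_Suc_atMost expsec_def by (simp add: exp_minus)
  finally have k: "poly (ginibre_poly N (real N) \<eta>) \<zeta> / of_nat N = exp (X z w) * expsec (N - 1) (X z w)" .
  have "of_real (exp (- (real N * ((cmod \<zeta>)^2 + (cmod \<eta>)^2) / 2)))
      = exp (- ((of_real (real N * (cmod \<zeta>)^2) + of_real (real N * (cmod \<eta>)^2)) / 2) :: complex)"
    by (simp add: exp_of_real[symmetric] algebra_simps)
  also have "\<dots> = exp (- ((X z z + X w w) / 2))" unfolding \<zeta>_def \<eta>_def XX ..
  finally have ex: "of_real (exp (- (real N * ((cmod \<zeta>)^2 + (cmod \<eta>)^2) / 2))) = exp (- ((X z z + X w w) / 2))" .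
  have im: "\<i> * of_real (s * Im z) = of_real s * (z - cnj z) / 2" for z
    by (simp add: complex_diff_cnj)
  have cn: "cnj (exp (- (\<i> * of_real (s * Im w)))) = exp (\<i> * of_real (s * Im w))"
    by (simp add: exp_cnj)
  have "exp (- (\<i> * of_real (s * Im z))) * cnj (exp (- (\<i> * of_real (s * Im w)))) * exp (- ((X z z + X w w) / 2)) * exp (X z w)
      = exp (- (\<i> * of_real (s * Im z)) + \<i> * of_real (s * Im w) - (X z z + X w w) / 2 + X z w)"
    unfolding cn exp_add[symmetric] by (rule arg_cong[of _ _ exp]) (simp only: diff_conv_add_uminus)
  also have "- (\<i> * of_real (s * Im z)) + \<i> * of_real (s * Im w) - (X z z + X w w) / 2 + X z w
      = z * cnj w - (z * cnj z) / 2 - (w * cnj w) / 2"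
    unfolding im X_def by (simp add: field_simps)
  also have "exp \<dots> = Gfun z w"
    unfolding Gfun_def complex_norm_square[symmetric] by simp
  finally have "exp (- (\<i> * of_real (s * Im z))) * cnj (exp (- (\<i> * of_real (s * Im w)))) * exp (- ((X z z + X w w) / 2)) * exp (X z w)
      = Gfun z w" .
  thus ?thesis unfolding X_def[symmetric] ex
    by (simp only: times_divide_eq_right[symmetric] k mult.assoc[symmetric])
qed

text \<open>Powers of the distance to \<open>a\<close> are written with \<open>exp\<close> and
  \<open>ln\<close>, not \<open>powr\<close>, so that here and in
  \<open>weight_factorization\<close> the identity also holds at \<open>a\<close>, where both sides
  use \<open>ln 0 = 0\<close>.\<close>

lemma kernel_weight:
  assumes N: "N > 0"
  shows "exp (- real N / 2 * (Qpot a c N z + Qpot a c N w)) =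
     exp (c * ln (cmod (z - of_real a))) * exp (c * ln (cmod (w - of_real a))) * exp (- (real N * ((cmod z)^2 + (cmod w)^2) / 2))"
  using N by (simp add: Qpot_def exp_add[symmetric] field_simps)

lemma weight_factorization:
  assumes N: "N > 0"
  shows "exp (- real N * Qpot a c N z) = exp (2 * c * ln (cmod (z - of_real a))) * exp (- real N * (cmod z)^2)"
  using N by (simp add: Qpot_def exp_add[symmetric] field_simps)

text \<open>The midpoint of 1 and \<open>a\<close> leaves room on both sides: the disc contains a
  neighbourhood of the unit disc and stays away from the cut of \<open>Ln (a - z)\<close>, which
  runs from \<open>a\<close> to infinity along the real axis.\<close>

lemma analytic_weight_point_charge:
  assumes a: "a > 1" and on: "orthonormal_polys (\<lambda>z. exp (- real 1 * Qpot a c 1 z)) p"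
  shows "analytic_weight (\<lambda>z. exp (2 * c * ln (cmod (z - of_real a)))) (\<lambda>z. exp (- (of_real c * Ln (of_real a - z)))) ((1 + a) / 2) a"
proof
  show "1 < (1 + a) / 2" "(1 + a) / 2 < a" using a by auto
  have re: "of_real a - z \<notin> \<real>\<^sub>\<le>\<^sub>0" if "cmod z < a" for z
    using that complex_Re_le_cmod[of z] by (auto simp: complex_nonpos_Reals_iff)
  show "(\<lambda>z. exp (- (of_real c * Ln (of_real a - z)))) holomorphic_on ball 0 a"
    using re by (intro holomorphic_intros) auto
  show "exp (- (complex_of_real c * Ln (of_real a - z))) \<noteq> 0" for z by simp
  show "0 \<le> exp (2 * c * ln (cmod (z - of_real a)))" for z by simp
  show "exp (2 * c * ln (cmod (z - of_real a))) * (cmod (exp (- (of_real c * Ln (of_real a - z)))))\<^sup>2 = 1"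
    if "cmod z \<le> (1 + a) / 2" for z
  proof -
    have "cmod z < a" using that a by simp
    hence "of_real a - z \<noteq> 0" by auto
    hence "Re (Ln (of_real a - z)) = ln (cmod (z - of_real a))" by (simp add: norm_minus_commute)
    hence "(cmod (exp (- (of_real c * Ln (of_real a - z)))))\<^sup>2 = exp (- (2 * c * ln (cmod (z - of_real a))))"
      by (simp add: exp_double[symmetric] mult_ac)
    thus ?thesis by (simp add: exp_add[symmetric])
  qed
  \<comment> \<open>\<open>p 0\<close> is a nonzero constant, so its integrability condition for
    \<open>N = 1\<close> contains that of \<open>V\<close> against
    \<open>exp (- (cmod z)^2)\<close>.\<close>
  define l where "l = coeff (p 0) 0"
  have l: "l \<noteq> 0" "poly (p 0) z = l" for z
  proof -
    have d: "degree (p 0) = 0" using on unfolding orthonormal_polys_def by blast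
    have "Re (lead_coeff (p 0)) > 0" using on unfolding orthonormal_polys_def by blast
    thus "l \<noteq> 0" using d by (auto simp: l_def)
    show "poly (p 0) z = l" using degree_eq_zeroE[OF d] by (metis coeff_pCons_0 l_def poly_pCons poly_0 mult_zero_right add.right_neutral)
  qed
  have "integrable lborel (\<lambda>z. poly (p 0) z * cnj (poly (p 0) z) * of_real (exp (- real 1 * Qpot a c 1 z) / pi))"
    using on unfolding orthonormal_polys_def by blast
  hence "integrable lborel (\<lambda>z. (of_real pi / (l * cnj l)) * (l * cnj l * of_real (exp (- real 1 * Qpot a c 1 z) / pi)))"
    unfolding l(2) by (rule integrable_mult_right)
  hence "integrable lborel (\<lambda>z. complex_of_real (exp (- real 1 * Qpot a c 1 z)))" using l(1) by simp
  from integrable_Re[OF this]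
  show "integrable lborel (\<lambda>z. exp (2 * c * ln (cmod (z - of_real a))) * exp (- ((cmod z)\<^sup>2)))"
    using weight_factorization[of 1 a c] by simp
qed

section \<open>Uniform limits at moving arguments\<close>

lemma uniform_limit_of_tendsto:
  "(f \<longlongrightarrow> l) F \<Longrightarrow> uniform_limit S (\<lambda>n x. f n) (\<lambda>_. l) F"
  by (rule uniform_limitI) (auto dest!: tendstoD elim: eventually_mono)

lemma uniform_limit_compose_moving:
  fixes H :: "nat \<Rightarrow> 'a :: metric_space \<Rightarrow> 'b :: metric_space"
  assumes H: "uniform_limit K H f F" and f: "uniformly_continuous_on K f" and K: "closed K"
    and v: "uniform_limit A v v0 F" and ev: "\<forall>\<^sub>F n in F. \<forall>q\<in>A. v n q \<in> K"
  shows "uniform_limit A (\<lambda>n q. H n (v n q)) (\<lambda>q. f (v0 q)) F"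
proof (rule uniform_limitI)
  fix e :: real assume "e > 0"
  hence e: "e / 2 > 0" by simp
  have "uniform_limit A (\<lambda>n q. f (v n q)) (\<lambda>q. f (v0 q)) F"
    by (rule uniform_limit_compose_uniformly_continuous_on[OF v f ev K])
  from uniform_limitD[OF this e] uniform_limitD[OF H e] ev
  show "\<forall>\<^sub>F n in F. \<forall>q\<in>A. dist (H n (v n q)) (f (v0 q)) < e"
  proof (eventually_elim, intro ballI)
    fix n q assume 1: "\<forall>q\<in>A. dist (f (v n q)) (f (v0 q)) < e / 2" "\<forall>x\<in>K. dist (H n x) (f x) < e / 2" "\<forall>q\<in>A. v n q \<in> K" and q: "q \<in> A"
    have "dist (H n (v n q)) (f (v n q)) < e / 2" "dist (f (v n q)) (f (v0 q)) < e / 2" using 1 q by auto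
    thus "dist (H n (v n q)) (f (v0 q)) < e"
      using dist_triangle[of "H n (v n q)" "f (v0 q)" "f (v n q)"] by linarith
  qed
qed

text \<open>Continuity is inherited from the sections of the exponential series through their
  uniform limit, so the contour integral need not be examined.\<close>

lemma continuous_on_cerfc: "continuous_on (cball 0 R) cerfc"
proof -
  have "continuous_on (cball 0 R) (\<lambda>v. cerfc v / 2)"
  proof (rule uniform_limit_theorem[OF _ expsec_uniform_limit])
    show "\<forall>\<^sub>F n in sequentially. continuous_on (cball 0 R) (\<lambda>v::complex. expsec n (of_nat n + of_real (sqrt (2 * real n)) * v))"
      unfolding expsec_def by (intro always_eventually allI continuous_intros) auto
  qed simp
  from continuous_on_mult_left[OF this, of 2] show ?thesis by simp
qed

lemma edge_argument_le:
  assumes "cmod z \<le> M" "cmod w \<le> M"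
  shows "cmod ((z + cnj w) / of_real (sqrt 2)) \<le> 2 * M"
proof -
  have "cmod (z + cnj w) \<le> 2 * M" using assms norm_triangle_ineq[of z "cnj w"] by simp
  hence "cmod (z + cnj w) / sqrt 2 \<le> 2 * M / 1"
    using order_trans[OF norm_ge_zero assms(1)] by (intro frac_le) auto
  thus ?thesis by (simp add: norm_divide)
qed

text \<open>The section has index \<open>N - 1\<close> while its argument is centred at
  \<open>N\<close>. The argument is rewritten as \<open>(N - 1) + sqrt (2 * (N - 1)) * v N q\<close>
  with \<open>v N q\<close> uniformly convergent, and \<open>expsec_uniform_limit\<close> is applied
  at moving points.\<close>

lemma expsec_edge_limit:
  assumes S: "\<And>z. z \<in> S \<Longrightarrow> cmod z \<le> M"
  shows "uniform_limit (S \<times> S)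
     (\<lambda>N q. expsec (N - 1) (of_nat N + of_real (sqrt (real N)) * (fst q + cnj (snd q)) + fst q * cnj (snd q)))
     (\<lambda>q. cerfc ((fst q + cnj (snd q)) / of_real (sqrt 2)) / 2) sequentially"
proof -
  \<comment> \<open>\<alpha> carries the shift by 1 and the product \<open>z * cnj w\<close>, both
    negligible at this scale; \<beta> is the ratio of the scales \<open>sqrt N\<close> and
    \<open>sqrt (2 * (N - 1))\<close>, the source of the \<open>sqrt 2\<close> in the limit.\<close>
  define \<alpha> where "\<alpha> N = complex_of_real (1 / sqrt (2 * (real N - 1)))" for N
  define \<beta> where "\<beta> N = complex_of_real (sqrt (real N) / sqrt (2 * (real N - 1)))" for N
  have \<alpha>: "\<alpha> \<longlonglongrightarrow> of_real 0" unfolding \<alpha>_def[abs_def] by (intro tendsto_of_real) real_asymp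
  have \<beta>: "\<beta> \<longlonglongrightarrow> of_real (1 / sqrt 2)" unfolding \<beta>_def[abs_def]
    by (intro tendsto_of_real) (real_asymp simp: powr_half_sqrt inverse_eq_divide)
  define v where "v N q = \<alpha> N + \<beta> N * (fst q + cnj (snd q)) + \<alpha> N * (fst q * cnj (snd q))" for N q
  have b1: "bounded ((\<lambda>q. fst q + cnj (snd q)) ` (S \<times> S))"
  proof (rule boundedI[of _ "M + M"])
    fix x assume "x \<in> (\<lambda>q. fst q + cnj (snd q)) ` (S \<times> S)"
    then obtain z w where "z \<in> S" "w \<in> S" "x = z + cnj w" by auto
    thus "norm x \<le> M + M" using S[of z] S[of w] norm_triangle_ineq[of z "cnj w"] by simp
  qed
  have b2: "bounded ((\<lambda>q. fst q * cnj (snd q)) ` (S \<times> S))"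
  proof (rule boundedI[of _ "M * M"])
    fix x assume "x \<in> (\<lambda>q. fst q * cnj (snd q)) ` (S \<times> S)"
    then obtain z w where "z \<in> S" "w \<in> S" "x = z * cnj w" by auto
    thus "norm x \<le> M * M" using S[of z] S[of w] order_trans[OF norm_ge_zero S[of z]]
      by (auto simp: norm_mult intro!: mult_mono)
  qed
  have bc: "bounded ((\<lambda>_. d) ` A)" for d :: complex and A :: "(complex \<times> complex) set"
    by (rule finite_imp_bounded) (auto intro: finite_subset[of _ "{d}"])
  have v: "uniform_limit (S \<times> S) v (\<lambda>q. of_real 0 + of_real (1 / sqrt 2) * (fst q + cnj (snd q)) + of_real 0 * (fst q * cnj (snd q))) sequentially"
    unfolding v_def[abs_def]
    by (intro uniform_limit_add uniform_lim_mult uniform_limit_of_tendsto \<alpha> \<beta> uniform_limit_const b1 b2 bc)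
  hence v: "uniform_limit (S \<times> S) v (\<lambda>q. (fst q + cnj (snd q)) / of_real (sqrt 2)) sequentially" by (simp add: of_real_divide)
  define K where "K = cball (0::complex) (2 * M + 1)"
  have kin: "\<forall>\<^sub>F N in sequentially. \<forall>q\<in>S \<times> S. v N q \<in> K"
    using uniform_limitD[OF v zero_less_one]
  proof (eventually_elim, intro ballI)
    fix N q assume 1: "\<forall>q\<in>S \<times> S. dist (v N q) ((fst q + cnj (snd q)) / of_real (sqrt 2)) < 1" and q: "q \<in> S \<times> S"
    have "cmod ((fst q + cnj (snd q)) / of_real (sqrt 2)) \<le> 2 * M"
      using edge_argument_le[of "fst q" M "snd q"] q S by auto
    moreover have "cmod (v N q) \<le> cmod ((fst q + cnj (snd q)) / of_real (sqrt 2)) + cmod (v N q - (fst q + cnj (snd q)) / of_real (sqrt 2))"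
      by (rule norm_triangle_sub)
    moreover have "cmod (v N q - (fst q + cnj (snd q)) / of_real (sqrt 2)) < 1" using 1 q by (auto simp: dist_norm)
    ultimately show "v N q \<in> K" by (simp add: K_def)
  qed
  have kuc: "uniformly_continuous_on K (\<lambda>v. cerfc v / 2)"
    unfolding K_def by (intro compact_uniformly_continuous continuous_intros continuous_on_cerfc compact_cball) auto
  have klim: "uniform_limit K (\<lambda>N v. expsec (N - 1) (of_nat (N - 1) + of_real (sqrt (2 * real (N - 1))) * v)) (\<lambda>v. cerfc v / 2) sequentially"
    using filterlim_compose[OF expsec_uniform_limit[of "2 * M + 1"] filterlim_minus_const_nat_at_top[of 1]] unfolding K_def by simp
  have "uniform_limit (S \<times> S) (\<lambda>N q. expsec (N - 1) (of_nat (N - 1) + of_real (sqrt (2 * real (N - 1))) * v N q))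
      (\<lambda>q. cerfc ((fst q + cnj (snd q)) / of_real (sqrt 2)) / 2) sequentially"
    by (rule uniform_limit_compose_moving[OF klim kuc _ v kin]) (simp add: K_def)
  moreover have "\<forall>\<^sub>F N in sequentially. \<forall>q\<in>S \<times> S.
      expsec (N - 1) (of_nat (N - 1) + of_real (sqrt (2 * real (N - 1))) * v N q) =
      expsec (N - 1) (of_nat N + of_real (sqrt (real N)) * (fst q + cnj (snd q)) + fst q * cnj (snd q))"
    using eventually_gt_at_top[of 1]
  proof (eventually_elim, intro ballI)
    fix N :: nat and q assume N: "1 < N"
    define d where "d = complex_of_real (sqrt (2 * (real N - 1)))"
    have d: "d \<noteq> 0" using N by (simp add: d_def)
    have ab: "\<alpha> N = 1 / d" "\<beta> N = of_real (sqrt (real N)) / d" "complex_of_real (sqrt (2 * real (N - 1))) = d"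
      using N by (simp_all add: \<alpha>_def \<beta>_def d_def of_nat_diff)
    have "of_nat (N - 1) + d * v N q = of_nat (N - 1) + 1 + of_real (sqrt (real N)) * (fst q + cnj (snd q)) + fst q * cnj (snd q)"
      unfolding v_def ab(1,2) using d by (simp add: field_simps)
    also have "of_nat (N - 1) + 1 = (of_nat N :: complex)" using N by (simp add: of_nat_diff)
    finally show "expsec (N - 1) (of_nat (N - 1) + of_real (sqrt (2 * real (N - 1))) * v N q) =
      expsec (N - 1) (of_nat N + of_real (sqrt (real N)) * (fst q + cnj (snd q)) + fst q * cnj (snd q))" unfolding ab(3) by simp
  qed
  ultimately show ?thesis by (subst (asm) uniform_limit_cong) auto
qed

theorem theorem1p2:
  fixes a c :: real and P :: "nat \<Rightarrow> nat \<Rightarrow> complex poly" and p :: complex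
  assumes "a > 1" and "c > -1"
    and "\<forall>N\<ge>1. orthonormal_polys (\<lambda>z. exp (- real N * Qpot a c N z)) (P N)"
    and "cmod p = 1"
  shows "\<exists>g :: nat \<Rightarrow> complex \<Rightarrow> complex.
           (\<forall>N. continuous_on UNIV (g N) \<and> (\<forall>z. cmod (g N z) = 1)) \<and>
           (\<forall>S. compact S \<longrightarrow>
              uniform_limit (S \<times> S)
                (\<lambda>N (z, w). g N z * cnj (g N w) *
                   kernel a c P N (p + p * z / of_real (sqrt (real N)))
                                  (p + p * w / of_real (sqrt (real N))) / of_nat N)
                (\<lambda>(z, w). Gfun z w * cerfc ((z + cnj w) / of_real (sqrt 2)) / 2)
                sequentially)"
proof -
  define V where "V z = exp (2 * c * ln (cmod (z - of_real a)))" for z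
  define \<phi> where "\<phi> z = exp (- (of_real c * Ln (of_real a - z)))" for z
  define r where "r = (1 + a) / 2"
  have r1: "r > 1" using \<open>a > 1\<close> by (simp add: r_def)
  have on1: "orthonormal_polys (\<lambda>z. exp (- real 1 * Qpot a c 1 z)) (P 1)" using assms(3) by blast
  interpret analytic_weight V \<phi> r a
    using analytic_weight_point_charge[OF \<open>a > 1\<close> on1] unfolding V_def[abs_def] \<phi>_def[abs_def] r_def .
  have on: "\<forall>N\<ge>1. orthonormal_polys (\<lambda>z. V z * exp (- real N * (cmod z)^2)) (P N)"
  proof (intro allI impI)
    fix N :: nat assume N: "N \<ge> 1"
    have "(\<lambda>z. exp (- real N * Qpot a c N z)) = (\<lambda>z. V z * exp (- real N * (cmod z)^2))"
      using N by (intro ext) (subst weight_factorization, auto simp: V_def)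
    thus "orthonormal_polys (\<lambda>z. V z * exp (- real N * (cmod z)^2)) (P N)" using assms(3) N by metis
  qed
  define W where "W z = exp (c * ln (cmod (z - of_real a)))" for z
  have W: "W z = cmod (1 / \<phi> z)" if "cmod z \<le> r" for z
  proof -
    have "V z = (W z)^2" by (simp add: V_def W_def exp_double[symmetric] mult_ac)
    hence "(W z * cmod (\<phi> z))^2 = 1" using V_eq[OF that] by (simp add: power_mult_distrib)
    hence "W z * cmod (\<phi> z) = 1" by (simp add: W_def power2_eq_1_iff) (smt (verit) exp_gt_zero mult_nonneg_nonneg norm_ge_zero)
    thus ?thesis by (simp add: norm_divide field_simps \<phi>_def)
  qed
  obtain B where B: "B \<ge> 1" "\<And>z. cmod z \<le> r \<Longrightarrow> cmod (\<phi> z) \<le> B" "\<And>z. cmod z \<le> r \<Longrightarrow> cmod (1 / \<phi> z) \<le> B"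
    using bounded_symbol by blast
  \<comment> \<open>The phase of \<phi>, all that the weight factors \<open>W\<close> leave of it on
    the disc. By continuity at \<open>p\<close>, the product
    \<open>u \<zeta> * cnj (u \<eta>)\<close> tends to \<open>u p * cnj (u p) = 1\<close>, so this
    phase need not enter the cocycle.\<close>
  define u where "u z = \<phi> z * of_real (cmod (1 / \<phi> z))" for z
  have norm_u: "cmod (u z) = 1" for z by (simp add: u_def norm_mult norm_divide \<phi>_def)
  have cont_u: "continuous_on (cball 0 r) u"
    unfolding u_def
    by (intro continuous_intros continuous_on_subset[OF holomorphic_on_imp_continuous_on[OF holo]])
       (use rR in \<open>auto simp: \<phi>_def\<close>)
  \<comment> \<open>Cancels the oscillation \<open>exp (\<i> * sqrt N * (Im z - Im w))\<close> of
    the Ginibre kernel found in \<open>ginibre_rescaled\<close>.\<close>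
  define g where "g N z = exp (- (\<i> * of_real (sqrt (real N) * Im z)))" for N :: nat and z
  define pt where "pt N z = p + p * z / of_real (sqrt (real N))" for N :: nat and z
  have norm_g: "cmod (g N z) = 1" for N z by (simp add: g_def)
  have cont_g: "continuous_on UNIV (g N)" for N unfolding g_def by (intro continuous_intros)
  have "uniform_limit (S \<times> S) (\<lambda>N (z, w). g N z * cnj (g N w) * kernel a c P N (pt N z) (pt N w) / of_nat N)
          (\<lambda>(z, w). Gfun z w * cerfc ((z + cnj w) / of_real (sqrt 2)) / 2) sequentially" if S: "compact S" for S
  proof -
    obtain M where M: "\<And>z. z \<in> S \<Longrightarrow> cmod z \<le> M"
      using compact_imp_bounded[OF S] by (auto simp: bounded_iff)
    have dpt: "dist (pt N z) p \<le> \<bar>M\<bar> / sqrt (real N)" if "z \<in> S" for N z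
      using M[OF that] \<open>cmod p = 1\<close> by (simp add: pt_def dist_norm norm_mult norm_divide divide_right_mono)
    have M0: "(\<lambda>N. \<bar>M\<bar> / sqrt (real N)) \<longlonglongrightarrow> 0" by real_asymp
    have lim_pt: "uniform_limit S pt (\<lambda>_. p) sequentially"
    proof (rule uniform_limitI)
      fix e :: real assume "e > 0"
      show "\<forall>\<^sub>F N in sequentially. \<forall>z\<in>S. dist (pt N z) p < e"
        using order_tendstoD(2)[OF M0 \<open>e > 0\<close>]
      proof (eventually_elim, intro ballI)
        fix N z assume "\<bar>M\<bar> / sqrt (real N) < e" "z \<in> S"
        thus "dist (pt N z) p < e" using dpt[of z N] by linarith
      qed
    qed
    have pt_in: "\<forall>\<^sub>F N in sequentially. \<forall>z\<in>S. pt N z \<in> cball 0 r"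
    proof -
      have "r - 1 > 0" using r1 by simp
      from uniform_limitD[OF lim_pt this] show ?thesis
      proof (eventually_elim, intro ballI)
        fix N z assume "\<forall>z\<in>S. dist (pt N z) p < r - 1" "z \<in> S"
        hence "cmod (pt N z - p) < r - 1" by (simp add: dist_norm)
        thus "pt N z \<in> cball 0 r" using norm_triangle_sub[of "pt N z" p] \<open>cmod p = 1\<close> by simp
      qed
    qed
    have bdd: "bounded (f ` (S \<times> S))" if "continuous_on (S \<times> S) f" for f :: "complex \<times> complex \<Rightarrow> complex"
      using that S by (intro compact_imp_bounded compact_continuous_image compact_Times)
    have lim_u: "uniform_limit S (\<lambda>N z. u (pt N z)) (\<lambda>_. u p) sequentially"
      by (rule uniform_limit_compose_uniformly_continuous_on[OF lim_pt _ pt_in])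
         (auto intro!: compact_uniformly_continuous cont_u)
    have lim_uu: "uniform_limit (S \<times> S) (\<lambda>N q. u (pt N (fst q)) * cnj (u (pt N (snd q)))) (\<lambda>q. u p * cnj (u p)) sequentially"
      by (intro uniform_lim_mult bounded_linear.uniform_limit[OF bounded_linear_cnj] bdd continuous_intros
            uniform_limit_compose'[OF lim_u, of fst "S \<times> S"] uniform_limit_compose'[OF lim_u, of snd "S \<times> S"]) auto
    define F where "F N q = expsec (N - 1) (of_nat N + of_real (sqrt (real N)) * (fst q + cnj (snd q)) + fst q * cnj (snd q))"
      for N :: nat and q :: "complex \<times> complex"
    have lim_F: "uniform_limit (S \<times> S) F (\<lambda>q. cerfc ((fst q + cnj (snd q)) / of_real (sqrt 2)) / 2) sequentially"
      unfolding F_def[abs_def] by (rule expsec_edge_limit[OF M])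
    have cont_erfc: "continuous_on (S \<times> S) (\<lambda>q. cerfc ((fst q + cnj (snd q)) / of_real (sqrt 2)) / 2)"
    proof (intro continuous_intros)
      show "continuous_on (S \<times> S) (\<lambda>q. cerfc ((fst q + cnj (snd q)) / of_real (sqrt 2)))"
        by (rule continuous_on_compose2[OF continuous_on_cerfc[of "2 * M"]])
           (use edge_argument_le M in \<open>auto intro!: continuous_intros\<close>)
    qed auto
    have cont_G: "continuous_on (S \<times> S) (\<lambda>q. Gfun (fst q) (snd q))"
      unfolding Gfun_def by (intro continuous_intros) auto
    have lim_main: "uniform_limit (S \<times> S) (\<lambda>N q. u (pt N (fst q)) * cnj (u (pt N (snd q))) * (Gfun (fst q) (snd q) * F N q))
        (\<lambda>q. u p * cnj (u p) * (Gfun (fst q) (snd q) * (cerfc ((fst q + cnj (snd q)) / of_real (sqrt 2)) / 2))) sequentially"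
      by (intro uniform_lim_mult lim_uu lim_F uniform_limit_const bdd continuous_intros cont_erfc cont_G)
    define L where "L N q = g N (fst q) * cnj (g N (snd q)) * kernel a c P N (pt N (fst q)) (pt N (snd q)) / of_nat N"
      for N :: nat and q
    have lim_err: "uniform_limit (S \<times> S) (\<lambda>N q. L N q - u (pt N (fst q)) * cnj (u (pt N (snd q))) * (Gfun (fst q) (snd q) * F N q))
        (\<lambda>_. 0) sequentially"
    proof (rule uniform_limitI)
      fix e :: real assume e: "e > 0"
      \<comment> \<open>The two weight factors \<open>W\<close> are at most \<open>B\<close> each on
        the disc, so a relative kernel error \<open>d\<close> becomes at most
        \<open>B^2 * d\<close>.\<close>
      define d where "d = e / (2 * B\<^sup>2)"
      have d: "d > 0" "B\<^sup>2 * d < e" using e B(1) by (auto simp: d_def)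
      show "\<forall>\<^sub>F N in sequentially. \<forall>q\<in>S \<times> S. dist (L N q - u (pt N (fst q)) * cnj (u (pt N (snd q))) * (Gfun (fst q) (snd q) * F N q)) 0 < e"
        using reproducing_kernel_limit[OF on d(1)] pt_in eventually_gt_at_top[of 0]
      proof (eventually_elim, intro ballI)
        fix N :: nat and q
        assume N: "0 < N" and q: "q \<in> S \<times> S" and ptr: "\<forall>z\<in>S. pt N z \<in> cball 0 r"
          and rk: "\<forall>z w. cmod z \<le> r \<longrightarrow> cmod w \<le> r \<longrightarrow>
             cmod (poly (reproducing_poly (P N) N w) z - \<phi> z * cnj (\<phi> w) * poly (ginibre_poly N (real N) w) z)
               \<le> d * (real N * exp (real N * ((cmod z)^2 + (cmod w)^2) / 2))"
        define z w where "z = fst q" and "w = snd q"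
        define \<zeta> \<eta> where "\<zeta> = pt N z" and "\<eta> = pt N w"
        have zr: "cmod \<zeta> \<le> r" "cmod \<eta> \<le> r" using ptr q by (auto simp: \<zeta>_def \<eta>_def z_def w_def)
        define Y where "Y = real N * ((cmod \<zeta>)^2 + (cmod \<eta>)^2) / 2"
        define K where "K = poly (reproducing_poly (P N) N \<eta>) \<zeta>"
        define k where "k = poly (ginibre_poly N (real N) \<eta>) \<zeta>"
        define gg where "gg = g N z * cnj (g N w)"
        have gg1: "cmod gg = 1" by (simp add: gg_def norm_mult norm_g)
        have LL: "L N q = gg * (of_real (W \<zeta> * W \<eta> * exp (- Y)) * K) / of_nat N"
          unfolding L_def kernel_def kernel_weight[OF N] K_def poly_reproducing_poly gg_def W_def Y_def \<zeta>_def \<eta>_def z_def w_def ..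
        have GF: "gg * of_real (exp (- Y)) * k / of_nat N = Gfun z w * F N q"
          using ginibre_rescaled[OF \<open>cmod p = 1\<close> N, of z w]
          unfolding gg_def g_def Y_def k_def \<zeta>_def \<eta>_def pt_def F_def z_def w_def by simp
        have uW: "u \<zeta> * cnj (u \<eta>) = \<phi> \<zeta> * cnj (\<phi> \<eta>) * of_real (W \<zeta> * W \<eta>)"
          using W zr by (simp add: u_def)
        have "L N q - u \<zeta> * cnj (u \<eta>) * (Gfun z w * F N q) = gg * of_real (W \<zeta> * W \<eta> * exp (- Y)) * (K - \<phi> \<zeta> * cnj (\<phi> \<eta>) * k) / of_nat N"
          unfolding LL uW GF[symmetric] by (simp add: algebra_simps diff_divide_distrib)
        also have "cmod \<dots> = W \<zeta> * W \<eta> * exp (- Y) * cmod (K - \<phi> \<zeta> * cnj (\<phi> \<eta>) * k) / real N"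
          unfolding norm_divide norm_mult gg1 by (simp add: W_def norm_mult)
        also have "\<dots> \<le> W \<zeta> * W \<eta> * exp (- Y) * (d * (real N * exp Y)) / real N"
          using rk zr by (intro divide_right_mono mult_left_mono) (auto simp: K_def k_def Y_def W_def)
        also have "\<dots> = W \<zeta> * W \<eta> * d" using N by (simp add: exp_minus field_simps)
        also have "\<dots> \<le> B * B * d" using W zr B d by (intro mult_right_mono mult_mono) auto
        also have "\<dots> < e" using d by (simp add: power2_eq_square)
        finally show "dist (L N q - u (pt N (fst q)) * cnj (u (pt N (snd q))) * (Gfun (fst q) (snd q) * F N q)) 0 < e"
          by (simp add: \<zeta>_def \<eta>_def z_def w_def)
      qed
    qed
    have "u p * cnj (u p) = 1" by (simp add: complex_norm_square[symmetric] norm_u)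
    hence "uniform_limit (S \<times> S) L (\<lambda>q. Gfun (fst q) (snd q) * cerfc ((fst q + cnj (snd q)) / of_real (sqrt 2)) / 2) sequentially"
      using uniform_limit_add[OF lim_err lim_main] by simp
    thus ?thesis by (simp add: L_def[abs_def] case_prod_unfold)
  qed
  hence "\<forall>S. compact S \<longrightarrow> uniform_limit (S \<times> S) (\<lambda>N (z, w). g N z * cnj (g N w) * kernel a c P N (pt N z) (pt N w) / of_nat N)
          (\<lambda>(z, w). Gfun z w * cerfc ((z + cnj w) / of_real (sqrt 2)) / 2) sequentially"
    by (intro allI impI)
  moreover have "\<forall>N. continuous_on UNIV (g N) \<and> (\<forall>z. cmod (g N z) = 1)"
    using norm_g cont_g by (intro allI conjI)
  ultimately show ?thesis unfolding pt_def by (intro exI[of _ g] conjI)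
qed

end
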